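(* Let $n=2$ (the abelian surface $\mathbb{C}^2/(\mathbb{Z}^2+i\mathbb{Z}^2)$). Suppose that the Higgs tensor $\xi=\xi(y^1)$ depends only on $y^1$, solves the complex moment map equation $\xi^{ab}{}_{,ab}=0$, and does not have maximal rank, i.e. $\det\xi\equiv0$. Then one of the following holds. (i) $$\xi=\begin{pmatrix}0&0\\0&\xi^{22}(y^1)\end{pmatrix},$$ in which case (assuming $|\xi^{22}|<1$ everywhere, so that $u_0$ is admissible) the real moment map equation has the unique solution $u=u_0=\frac12|y|^2$, up to an additive constant. (ii) $$\xi=\begin{pmatrix}c&\xi^{12}(y^1)\\ \xi^{12}(y^1)&\frac{(\xi^{12}(y^1))^2}{c}\end{pmatrix},\qquad c\in\mathbb{C}^*,$$ and there is a solution $u(y)$ to the real moment map equation, unique up to additive constants, provided $|\xi^{12}(y^1)|\le|c|<\frac{3}{10}$. In both cases, $\xi$ corresponds to an integrable deformation if and only if it is constant.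
   Context: $\mathbb{T}^2=\mathbb{R}^2/\mathbb{Z}^2$ with coordinates $y=(y^1,y^2)$. Indices after a comma are partial derivatives, and repeated indices are summed. A symplectic potential is a function $u(y)=\frac12|y|^2+\phi(y)$ with $\phi$ smooth and $\mathbb{Z}^2$-periodic and $D^2u=(u_{ab})$ positive definite everywhere; $(u^{ab})$ is the inverse matrix. A Higgs tensor is a smooth $\mathbb{Z}^2$-periodic function $\xi=(\xi^{ab}(y))$ with values in complex symmetric $2\times2$ matrices; $\bar\xi$ is its complex conjugate. The real moment map equation for $u$, given $\xi$, is $$\left(\left(\mathbb{1}-\xi\,D^2u\,\bar\xi\,D^2u\right)^{1/2}(D^2u)^{-1}\right)^{ab}{}_{,ab}=0.$$ Solutions are symplectic potentials $u$ which are admissible, i.e. satisfy $r(\xi\,D^2u\,\bar\xi\,D^2u)<1$ everywhere ($r$ the spectral radius); in this case $\xi\,D^2u\,\bar\xi\,D^2u$ is diagonalizable with eigenvalues in $[0,1)$, and the square root is the unique one with positive eigenvalues. Integrability: given the solution $u$, the complex structure $J_u$ on $\mathbb C^2/(\mathbb Z^2+i\mathbb Z^2)$ has holomorphic coordinates $z^a=x^a+iw^a$ with $x=\nabla u(y)$, and $\xi$ represents the first-order deformation $\alpha^\vee=\alpha_c{}^{\bar b}\,dz^c\otimes\partial_{\bar z^b}$ with $\alpha_c{}^{\bar b}=u_{bd}\xi^{dc}$. The deformation is integrable if the first-order Maurer–Cartan equation $\partial_{z^a}\alpha_c{}^{\bar b}=\partial_{z^c}\alpha_a{}^{\bar b}$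 holds for all $a,b,c$, i.e. $u^{ae}\partial_{y^e}(u_{bd}\xi^{dc})$ is symmetric in $a,c$. *)

theory Defs
  imports "HOL-Analysis.Analysis"
begin

text \<open>Functions on the torus \<open>\<real>\<^sup>n/\<int>\<^sup>n\<close> are \<open>\<int>\<^sup>n\<close>-periodic functions on \<open>real^'n\<close>.\<close>

definition partial_deriv :: "'n \<Rightarrow> (real^'n \<Rightarrow> 'b) \<Rightarrow> real^'n \<Rightarrow> 'b::real_normed_vector"
  where "partial_deriv a f y = vector_derivative (\<lambda>t. f (y + t *\<^sub>R axis a 1)) (at 0)"

text \<open>All iterated partial derivatives, of every order, are (totally) differentiable
  everywhere; this is the usual notion of a \<open>C\<^sup>\<infinity>\<close> function.\<close>
definition smooth :: "(real^'n \<Rightarrow> 'b::real_normed_vector) \<Rightarrow> bool"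
  where "smooth f \<longleftrightarrow> (\<forall>as y. fold partial_deriv as f differentiable (at y))"

definition periodic :: "(real^'n \<Rightarrow> 'b) \<Rightarrow> bool"
  where "periodic f \<longleftrightarrow> (\<forall>y m. (\<forall>k. m $ k \<in> \<int>) \<longrightarrow> f (y + m) = f y)"

definition hessian :: "(real^'n \<Rightarrow> real) \<Rightarrow> real^'n \<Rightarrow> real^'n^'n"
  where "hessian u y = (\<chi> a b. partial_deriv b (partial_deriv a u) y)"

definition pos_def :: "real^'n^'n \<Rightarrow> bool"
  where "pos_def A \<longleftrightarrow> transpose A = A \<and> (\<forall>x. x \<noteq> 0 \<longrightarrow> 0 < x \<bullet> (A *v x))"

definition u0 :: "real^'n \<Rightarrow> real"
  where "u0 y = (norm y)\<^sup>2 / 2"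

definition symplectic_potential :: "(real^'n \<Rightarrow> real) \<Rightarrow> bool"
  where "symplectic_potential u \<longleftrightarrow>
    (\<exists>\<phi>. smooth \<phi> \<and> periodic \<phi> \<and> u = (\<lambda>y. u0 y + \<phi> y)) \<and> (\<forall>y. pos_def (hessian u y))"

definition higgs_tensor :: "(real^'n \<Rightarrow> complex^'n^'n) \<Rightarrow> bool"
  where "higgs_tensor \<xi> \<longleftrightarrow> smooth \<xi> \<and> periodic \<xi> \<and> (\<forall>y. transpose (\<xi> y) = \<xi> y)"

definition eigenvalue :: "complex^'n^'n \<Rightarrow> complex \<Rightarrow> bool"
  where "eigenvalue A l \<longleftrightarrow> (\<exists>x. x \<noteq> 0 \<and> A *v x = l *s x)"

definition spectral_radius :: "complex^'n^'n \<Rightarrow> real"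
  where "spectral_radius A = Max (cmod ` {l. eigenvalue A l})"

text \<open>The square root with positive real eigenvalues; it exists and is unique when \<open>A\<close> is
  diagonalizable with positive eigenvalues, which is the only case of interest here.\<close>
definition matrix_sqrt :: "complex^'n^'n \<Rightarrow> complex^'n^'n"
  where "matrix_sqrt A =
    (THE S. S ** S = A \<and> (\<forall>l. eigenvalue S l \<longrightarrow> l \<in> \<real> \<and> 0 < Re l))"

abbreviation hessian_c :: "(real^'n \<Rightarrow> real) \<Rightarrow> real^'n \<Rightarrow> complex^'n^'n"
  where "hessian_c u y \<equiv> map_matrix complex_of_real (hessian u y)"

definition higgs_endo ::
    "(real^'n \<Rightarrow> complex^'n^'n) \<Rightarrow> (real^'n \<Rightarrow> real) \<Rightarrow> real^'n \<Rightarrow> complex^'n^'n"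
  where "higgs_endo \<xi> u y =
    \<xi> y ** hessian_c u y ** map_matrix cnj (\<xi> y) ** hessian_c u y"

definition admissible :: "(real^'n \<Rightarrow> complex^'n^'n) \<Rightarrow> (real^'n \<Rightarrow> real) \<Rightarrow> bool"
  where "admissible \<xi> u \<longleftrightarrow> (\<forall>y. spectral_radius (higgs_endo \<xi> u y) < 1)"

text \<open>\<open>div2 A\<close> is \<open>A\<^sup>a\<^sup>b\<close> differentiated in \<open>y\<^sup>a\<close> and \<open>y\<^sup>b\<close>, summed over both indices.\<close>
definition div2 :: "(real^'n \<Rightarrow> complex^'n^'n) \<Rightarrow> real^'n \<Rightarrow> complex"
  where "div2 A y =
    (\<Sum>a\<in>UNIV. \<Sum>b\<in>UNIV. partial_deriv b (partial_deriv a (\<lambda>y. A y $ a $ b)) y)"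

definition complex_moment_map_eq :: "(real^'n \<Rightarrow> complex^'n^'n) \<Rightarrow> bool"
  where "complex_moment_map_eq \<xi> \<longleftrightarrow> (\<forall>y. div2 \<xi> y = 0)"

definition solves_real_moment_map ::
    "(real^'n \<Rightarrow> complex^'n^'n) \<Rightarrow> (real^'n \<Rightarrow> real) \<Rightarrow> bool"
  where "solves_real_moment_map \<xi> u \<longleftrightarrow>
    symplectic_potential u \<and> admissible \<xi> u \<and>
    (\<forall>y. div2 (\<lambda>y. matrix_sqrt (mat 1 - higgs_endo \<xi> u y) ** matrix_inv (hessian_c u y)) y = 0)"

definition deformation ::
    "(real^'n \<Rightarrow> complex^'n^'n) \<Rightarrow> (real^'n \<Rightarrow> real) \<Rightarrow> 'n \<Rightarrow> 'n \<Rightarrow> real^'n \<Rightarrow> complex"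
  where "deformation \<xi> u c b y = (\<Sum>d\<in>UNIV. hessian_c u y $ b $ d * \<xi> y $ d $ c)"

text \<open>The derivative in \<open>z\<^sup>a = x\<^sup>a + i w\<^sup>a\<close> of a \<open>w\<close>-independent function, written in the
  coordinates \<open>y\<close>: with \<open>x = \<nabla>u(y)\<close> the Jacobian of \<open>y\<close> with respect to \<open>x\<close> is the inverse
  Hessian, and the factor \<open>1/2\<close> comes from the Wirtinger derivative.\<close>
definition z_deriv ::
    "(real^'n \<Rightarrow> real) \<Rightarrow> 'n \<Rightarrow> (real^'n \<Rightarrow> complex) \<Rightarrow> real^'n \<Rightarrow> complex"
  where "z_deriv u a g y =
    (\<Sum>e\<in>UNIV. complex_of_real (matrix_inv (hessian u y) $ a $ e) * partial_deriv e g y) / 2"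

definition integrable_deformation ::
    "(real^'n \<Rightarrow> complex^'n^'n) \<Rightarrow> (real^'n \<Rightarrow> real) \<Rightarrow> bool"
  where "integrable_deformation \<xi> u \<longleftrightarrow>
    (\<forall>a b c y. z_deriv u a (deformation \<xi> u c b) y = z_deriv u c (deformation \<xi> u a b) y)"

end

theory Submission
  imports Defs
begin

text \<open>Since \<open>\<xi>\<close> depends on \<open>y\<^sup>1\<close> only, the complex moment map equation says that \<open>\<xi>\<^sup>1\<^sup>1\<close> is affine and
  periodic, hence constant, and \<open>det \<xi> = 0\<close> gives \<open>\<xi> = \<kappa> w w\<^sup>T\<close> with \<open>w = (0, 1)\<close> or \<open>w = (1, \<xi>\<^sup>1\<^sup>2 / c)\<close>.
  For such \<open>\<xi>\<close> the matrix in the real moment map equation is \<open>H\<^sup>-\<^sup>1 - bfun |\<kappa>|\<^sup>2 h w w\<^sup>*\<close>, where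
  \<open>H = D\<^sup>2u\<close> and \<open>h\<close> is linear in \<open>H\<close>. It is strictly monotone (decreasing) in \<open>H\<close>, so pairing the
  difference of the equations for two solutions with the difference of the potentials and integrating
  by parts twice over the torus shows that the Hessians agree.

  Uniqueness makes the Hessian of a solution invariant under translations preserving \<open>\<xi>\<close>. Hence it is
  \<open>diag (\<eta>(y\<^sup>1), 1)\<close>, integrability forces \<open>\<xi>\<^sup>2\<^sup>2\<close> and then \<open>\<xi>\<close> to be constant, and conversely constant
  \<open>\<xi>\<close> have solutions with constant Hessian. Existence in case (ii) reduces to a scalar equation for
  \<open>\<eta>\<close> at each point.\<close>

section \<open>Smooth functions\<close>

text \<open>The monotonicity has a variational origin. On symmetric \<open>H\<close> the flux is the
  gradient of log det \<open>H\<close> minus a convex function of \<open>h\<close>, hence of a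
  strictly concave function, on the convex set cut out by admissibility. Only real parts enter,
  because the imaginary part of w w' (a prime denoting conjugation) is antisymmetric and cancels
  against a difference of Hessians.

  The obstacle to existence is global: \<open>\<eta>\<close> - 1 must be the second derivative of a
  periodic function, so \<open>\<eta>\<close> must have mean 1. The intermediate value theorem is
  therefore used twice, pointwise to solve for \<open>b\<close> and then on the mean to choose
  \<open>K\<close>. The bound 3/10 is what makes 9/10 a usable lower end for \<open>K\<close>: there
  \<open>\<eta>\<close> \<ge> 1 means \<open>b\<close> \<le> 1/10, and this follows from r^2 + 1/100
  \<le> 1/10.

  A further obstacle is that \<open>matrix_sqrt\<close> is a definite description over all complex
  matrices, so a formula for the root becomes usable only after uniqueness is known among all
  competitors, diagonalizable or not.\<close>

lemma has_vector_derivative_partial_line: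
  assumes "f differentiable (at (y + s *\<^sub>R axis a 1))"
  shows "((\<lambda>t. f (y + t *\<^sub>R axis a 1)) has_vector_derivative
    partial_deriv a f (y + s *\<^sub>R axis a 1)) (at s)"
proof -
  obtain D where D: "(f has_derivative D) (at (y + s *\<^sub>R axis a 1))"
    using assms unfolding differentiable_def by blast
  interpret D: linear D using D has_derivative_linear by blast
  have *: "((\<lambda>t. f (z + t *\<^sub>R axis a 1)) has_vector_derivative D (axis a 1)) (at r)"
    if "z + r *\<^sub>R axis a 1 = y + s *\<^sub>R axis a 1" for z r
  proof -
    have "((\<lambda>t. z + t *\<^sub>R axis a 1) has_derivative (\<lambda>t. t *\<^sub>R axis a 1)) (at r)"
      by (auto intro!: derivative_eq_intros)
    from diff_chain_at[OF this, of f D] D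
    have "(f \<circ> (\<lambda>t. z + t *\<^sub>R axis a 1) has_derivative D \<circ> (\<lambda>t. t *\<^sub>R axis a 1)) (at r)"
      by (simp add: that)
    then show ?thesis
      unfolding has_vector_derivative_def by (simp add: o_def D.scaleR)
  qed
  have "partial_deriv a f (y + s *\<^sub>R axis a 1) = D (axis a 1)"
    unfolding partial_deriv_def by (rule vector_derivative_at[OF *]) simp
  then show ?thesis using *[of y s] by simp
qed

lemmas frechet_derivative_worksI = iffD1[OF frechet_derivative_works]

lemma partial_deriv_eqI:
  assumes "(f has_derivative D) (at y)"
  shows "partial_deriv a f y = D (axis a 1)"
proof -
  interpret D: linear D using assms has_derivative_linear by blast
  have "((\<lambda>t. y + t *\<^sub>R axis a 1) has_derivative (\<lambda>t. t *\<^sub>R axis a 1)) (at 0)"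
    by (auto intro!: derivative_eq_intros)
  from diff_chain_at[OF this, of f D] assms
  have "((\<lambda>t. f (y + t *\<^sub>R axis a 1)) has_vector_derivative D (axis a 1)) (at 0)"
    unfolding has_vector_derivative_def by (simp add: o_def D.scaleR)
  then show ?thesis unfolding partial_deriv_def by (rule vector_derivative_at)
qed

lemma frechet_partial:
  assumes "f differentiable (at y)"
  shows "frechet_derivative f (at y) (axis a 1) = partial_deriv a f y"
  using partial_deriv_eqI[OF frechet_derivative_worksI[OF assms]] by simp

lemma partial_deriv_const [simp]: "partial_deriv a (\<lambda>y. c) = (\<lambda>y. 0)"
  by (rule ext) (simp add: partial_deriv_def)

lemma partial_deriv_translate:
  "partial_deriv a (\<lambda>y. f (y + z)) = (\<lambda>y. partial_deriv a f (y + z))"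
  by (rule ext) (simp add: partial_deriv_def algebra_simps)

lemma partial_deriv_bounded_linear:
  assumes "bounded_linear L" "f differentiable (at y)"
  shows "partial_deriv a (\<lambda>y. L (f y)) y = L (partial_deriv a f y)"
  using partial_deriv_eqI[OF bounded_linear.has_derivative[OF assms(1) frechet_derivative_worksI[OF assms(2)]]]
    frechet_partial[OF assms(2)] by metis

lemma partial_deriv_add:
  assumes "f differentiable (at y)" "g differentiable (at y)"
  shows "partial_deriv a (\<lambda>y. f y + g y) y = partial_deriv a f y + partial_deriv a g y"
  using partial_deriv_eqI[OF has_derivative_add[OF assms[THEN frechet_derivative_worksI]]]
    frechet_partial[OF assms(1)] frechet_partial[OF assms(2)] by metis

lemma partial_deriv_mult:
  fixes f g :: "real^'n \<Rightarrow> 'b::real_normed_algebra"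
  assumes "f differentiable (at y)" "g differentiable (at y)"
  shows "partial_deriv a (\<lambda>y. f y * g y) y = f y * partial_deriv a g y + partial_deriv a f y * g y"
  using partial_deriv_eqI[OF has_derivative_mult[OF assms[THEN frechet_derivative_worksI]]]
    frechet_partial[OF assms(1)] frechet_partial[OF assms(2)] by metis

lemma has_derivative_real_compose:
  fixes f :: "real^'n \<Rightarrow> real"
  assumes "f differentiable (at y)" "(g has_real_derivative d) (at (f y))"
  shows "((\<lambda>y. g (f y)) has_derivative (\<lambda>v. frechet_derivative f (at y) v * d)) (at y)"
  using diff_chain_at[OF frechet_derivative_worksI[OF assms(1)], of g "(*) d"] assms(2)
  by (simp add: o_def has_field_derivative_def mult.commute)

lemma partial_deriv_real_compose:
  fixes f :: "real^'n \<Rightarrow> real"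
  assumes "f differentiable (at y)" "(g has_real_derivative d) (at (f y))"
  shows "partial_deriv a (\<lambda>y. g (f y)) y = partial_deriv a f y * d"
  using partial_deriv_eqI[OF has_derivative_real_compose[OF assms]] frechet_partial[OF assms(1)] by metis

lemma differentiable_real_compose:
  fixes f :: "real^'n \<Rightarrow> real"
  assumes "f differentiable (at y)" "(g has_real_derivative d) (at (f y))"
  shows "(\<lambda>y. g (f y)) differentiable (at y)"
  using has_derivative_real_compose[OF assms] unfolding differentiable_def by blast

text \<open>Provides a natural number to induct on. It counts how many derivatives are taken before
  differentiability is asked for, so order 0 already means differentiable, not merely
  continuous.\<close>

definition smooth_upto :: "nat \<Rightarrow> (real^'n \<Rightarrow> 'b::real_normed_vector) \<Rightarrow> bool"
  where "smooth_upto n f \<longleftrightarrow>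
    (\<forall>as y. length as \<le> n \<longrightarrow> fold partial_deriv as f differentiable (at y))"

lemma smooth_upto_0: "smooth_upto 0 f \<longleftrightarrow> (\<forall>y. f differentiable (at y))"
  by (simp add: smooth_upto_def)

text \<open>\<open>fold\<close> applies the head of the list first, so removing the head amounts to
  replacing \<open>f\<close> by one of its partial derivatives.\<close>

lemma smooth_upto_Suc:
  fixes f :: "real^'n \<Rightarrow> 'b::real_normed_vector"
  shows "smooth_upto (Suc n) f \<longleftrightarrow> (\<forall>y. f differentiable (at y)) \<and> (\<forall>a. smooth_upto n (partial_deriv a f))"
proof
  assume *: "smooth_upto (Suc n) f"
  have "fold partial_deriv as (partial_deriv a f) differentiable at y" if "length as \<le> n" for as a y
    using *[unfolded smooth_upto_def, rule_format, of "a # as" y] that by simp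
  moreover have "f differentiable at y" for y
    using *[unfolded smooth_upto_def, rule_format, of "[]" y] by simp
  ultimately show "(\<forall>y. f differentiable (at y)) \<and> (\<forall>a. smooth_upto n (partial_deriv a f))"
    by (auto simp: smooth_upto_def)
next
  assume *: "(\<forall>y. f differentiable (at y)) \<and> (\<forall>a. smooth_upto n (partial_deriv a f))"
  show "smooth_upto (Suc n) f" unfolding smooth_upto_def
  proof (intro allI impI)
    fix as :: "'n list" and y :: "real^'n" assume "length as \<le> Suc n"
    then show "fold partial_deriv as f differentiable at y"
      using * by (cases as) (auto simp: smooth_upto_def)
  qed
qed

lemma smooth_upto_differentiable: "smooth_upto n f \<Longrightarrow> f differentiable (at y)"
  by (cases n) (auto simp: smooth_upto_0 smooth_upto_Suc)

lemma smooth_upto_mono: "smooth_upto n f \<Longrightarrow> m \<le> n \<Longrightarrow> smooth_upto m f"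
  by (auto simp: smooth_upto_def)

lemma smooth_iff_upto: "smooth f \<longleftrightarrow> (\<forall>n. smooth_upto n f)"
  unfolding smooth_def smooth_upto_def by blast

lemma smooth_differentiable: "smooth f \<Longrightarrow> f differentiable (at y)"
  using smooth_upto_differentiable smooth_iff_upto by blast

lemma smooth_partial: "smooth f \<Longrightarrow> smooth (partial_deriv a f)"
  unfolding smooth_iff_upto using smooth_upto_Suc by blast

lemma smooth_continuous: "smooth f \<Longrightarrow> continuous_on S f"
  by (meson smooth_differentiable differentiable_imp_continuous_within
      continuous_at_imp_continuous_on)

lemma smooth_upto_const: "smooth_upto n (\<lambda>y. c)"
  by (induction n arbitrary: c) (simp_all add: smooth_upto_0 smooth_upto_Suc)

lemma bounded_linear_differentiable:
  "bounded_linear L \<Longrightarrow> f differentiable (at y) \<Longrightarrow> (\<lambda>y. L (f y)) differentiable (at y)"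
  unfolding differentiable_def using bounded_linear.has_derivative by blast

lemma smooth_upto_bounded_linear:
  assumes "bounded_linear L"
  shows "smooth_upto n f \<Longrightarrow> smooth_upto n (\<lambda>y. L (f y))"
proof (induction n arbitrary: f)
  case 0
  then show ?case
    by (metis smooth_upto_0 bounded_linear_differentiable[OF assms])
next
  case (Suc n)
  have "partial_deriv a (\<lambda>y. L (f y)) = (\<lambda>y. L (partial_deriv a f y))" for a
    using Suc.prems by (intro ext partial_deriv_bounded_linear assms) (auto simp: smooth_upto_Suc)
  with Suc show ?case
    by (simp add: smooth_upto_Suc bounded_linear_differentiable[OF assms])
qed

lemma smooth_upto_add:
  "smooth_upto n f \<Longrightarrow> smooth_upto n g \<Longrightarrow> smooth_upto n (\<lambda>y. f y + g y)"
proof (induction n arbitrary: f g)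
  case (Suc n)
  have "partial_deriv a (\<lambda>y. f y + g y) = (\<lambda>y. partial_deriv a f y + partial_deriv a g y)" for a
    using Suc.prems by (intro ext partial_deriv_add) (auto simp: smooth_upto_Suc)
  with Suc show ?case by (auto simp: smooth_upto_Suc)
qed (auto simp: smooth_upto_0)

lemma smooth_upto_mult:
  fixes f g :: "real^'n \<Rightarrow> 'b::real_normed_algebra"
  shows "smooth_upto n f \<Longrightarrow> smooth_upto n g \<Longrightarrow> smooth_upto n (\<lambda>y. f y * g y)"
proof (induction n arbitrary: f g)
  case (Suc n)
  have "partial_deriv a (\<lambda>y. f y * g y) = (\<lambda>y. f y * partial_deriv a g y + partial_deriv a f y * g y)" for a
    using Suc.prems by (intro ext partial_deriv_mult) (auto simp: smooth_upto_Suc)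
  moreover have "smooth_upto n f" "smooth_upto n g"
    using Suc.prems smooth_upto_mono[of "Suc n" _ n] by auto
  ultimately show ?case using Suc by (auto simp: smooth_upto_Suc intro!: smooth_upto_add)
qed (auto simp: smooth_upto_0)

text \<open>For implicitly defined functions, whose derivatives are expressed through the functions
  themselves.\<close>
lemma smooth_bootstrap:
  assumes "\<And>y. f differentiable (at y)"
    and "\<And>n a. smooth_upto n f \<Longrightarrow> smooth_upto n (partial_deriv a f)"
  shows "smooth f"
proof -
  have "smooth_upto n f" for n
    by (induction n) (use assms in \<open>auto simp: smooth_upto_0 smooth_upto_Suc\<close>)
  then show ?thesis by (simp add: smooth_iff_upto)
qed

text \<open>The derivative of 1/f is a polynomial in 1/f and a derivative of f, so the induction
  hypothesis for 1/f itself gives the next order.\<close>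

lemma smooth_upto_inverse:
  fixes f :: "real^'n \<Rightarrow> real"
  assumes "smooth_upto n f" "\<And>y. f y \<noteq> 0"
  shows "smooth_upto n (\<lambda>y. inverse (f y))"
  using assms(1)
proof (induction n)
  case 0
  then show ?case using assms(2) by (auto simp: smooth_upto_0)
next
  case (Suc n)
  have fn: "smooth_upto n f" using Suc.prems smooth_upto_mono[of "Suc n" _ n] by auto
  have "partial_deriv a (\<lambda>y. inverse (f y)) =
      (\<lambda>y. partial_deriv a f y * ((-1) * (inverse (f y) * inverse (f y))))" for a
  proof
    fix y
    show "partial_deriv a (\<lambda>y. inverse (f y)) y =
        partial_deriv a f y * ((-1) * (inverse (f y) * inverse (f y)))"
      using Suc.prems assms(2) DERIV_inverse[of "f y"]
      by (intro partial_deriv_real_compose) (auto simp: smooth_upto_Suc power2_eq_square)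
  qed
  moreover have "smooth_upto n (\<lambda>y. partial_deriv a f y * ((-1) * (inverse (f y) * inverse (f y))))" for a
    using Suc fn by (intro smooth_upto_mult smooth_upto_const) (auto simp: smooth_upto_Suc)
  ultimately show ?case using Suc.prems assms(2)
    by (auto simp: smooth_upto_Suc)
qed

lemma smooth_upto_sqrt:
  fixes f :: "real^'n \<Rightarrow> real"
  assumes "smooth_upto n f" "\<And>y. f y > 0"
  shows "smooth_upto n (\<lambda>y. sqrt (f y))"
proof -
  have diff: "(\<lambda>y. sqrt (f y)) differentiable at y" for y
    using smooth_upto_differentiable[OF assms(1)] DERIV_real_sqrt[OF assms(2)]
    by (rule differentiable_real_compose)
  show ?thesis using assms(1)
  proof (induction n)
    case 0
    then show ?case using diff by (simp add: smooth_upto_0)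
  next
    case (Suc n)
    have fn: "smooth_upto n f" using Suc.prems smooth_upto_mono[of "Suc n" _ n] by auto
    have eq: "partial_deriv a (\<lambda>y. sqrt (f y)) =
        (\<lambda>y. partial_deriv a f y * (inverse (sqrt (f y)) * (1/2)))" for a
      using partial_deriv_real_compose[OF smooth_upto_differentiable[OF Suc.prems]
          DERIV_real_sqrt[OF assms(2)]] by (intro ext) simp
    have "smooth_upto n (\<lambda>y. partial_deriv a f y * (inverse (sqrt (f y)) * (1/2)))" for a
      using Suc fn assms(2)
      by (intro smooth_upto_mult smooth_upto_const smooth_upto_inverse)
        (auto simp: smooth_upto_Suc less_imp_neq[THEN not_sym])
    then show ?case unfolding smooth_upto_Suc eq using diff by blast
  qed
qed

named_theorems smooth_intros

lemma smooth_const [smooth_intros]: "smooth (\<lambda>y. c)"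
  by (simp add: smooth_iff_upto smooth_upto_const)

lemma smooth_bounded_linear: "bounded_linear L \<Longrightarrow> smooth f \<Longrightarrow> smooth (\<lambda>y. L (f y))"
  by (simp add: smooth_iff_upto smooth_upto_bounded_linear)

lemma smooth_add [smooth_intros]: "smooth f \<Longrightarrow> smooth g \<Longrightarrow> smooth (\<lambda>y. f y + g y)"
  by (simp add: smooth_iff_upto smooth_upto_add)

lemma smooth_mult [smooth_intros]:
  fixes f g :: "real^'n \<Rightarrow> 'b::real_normed_algebra"
  shows "smooth f \<Longrightarrow> smooth g \<Longrightarrow> smooth (\<lambda>y. f y * g y)"
  by (simp add: smooth_iff_upto smooth_upto_mult)

lemma smooth_minus [smooth_intros]: "smooth f \<Longrightarrow> smooth (\<lambda>y. - f y)"
  by (rule smooth_bounded_linear[OF bounded_linear_minus[OF bounded_linear_ident]])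

lemma smooth_diff [smooth_intros]: "smooth f \<Longrightarrow> smooth g \<Longrightarrow> smooth (\<lambda>y. f y - g y)"
  using smooth_add[of f "\<lambda>y. - g y"] smooth_minus[of g] by simp

lemma smooth_Re [smooth_intros]: "smooth f \<Longrightarrow> smooth (\<lambda>y. Re (f y))"
  by (rule smooth_bounded_linear[OF bounded_linear_Re])

lemma smooth_cnj [smooth_intros]: "smooth f \<Longrightarrow> smooth (\<lambda>y. cnj (f y))"
  by (rule smooth_bounded_linear[OF bounded_linear_cnj])

lemma smooth_of_real [smooth_intros]: "smooth f \<Longrightarrow> smooth (\<lambda>y. complex_of_real (f y))"
  by (rule smooth_bounded_linear[OF bounded_linear_of_real])

lemma smooth_vec_nth [smooth_intros]: "smooth f \<Longrightarrow> smooth (\<lambda>y. f y $ a)"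
  by (rule smooth_bounded_linear[OF bounded_linear_vec_nth])

lemma smooth_divide [smooth_intros]:
  fixes f :: "real^'n \<Rightarrow> real"
  shows "smooth f \<Longrightarrow> smooth g \<Longrightarrow> (\<And>y. g y \<noteq> 0) \<Longrightarrow> smooth (\<lambda>y. f y / g y)"
  using smooth_mult[of f "\<lambda>y. inverse (g y)"]
  by (auto simp: smooth_iff_upto smooth_upto_inverse divide_inverse)

lemma smooth_sqrt [smooth_intros]:
  fixes f :: "real^'n \<Rightarrow> real"
  shows "smooth f \<Longrightarrow> (\<And>y. f y > 0) \<Longrightarrow> smooth (\<lambda>y. sqrt (f y))"
  by (simp add: smooth_iff_upto smooth_upto_sqrt)

lemma partial_deriv_smooth_add:
  "smooth f \<Longrightarrow> smooth g \<Longrightarrow>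
   partial_deriv a (\<lambda>y. f y + g y) = (\<lambda>y. partial_deriv a f y + partial_deriv a g y)"
  by (intro ext partial_deriv_add smooth_differentiable)

lemma partial_deriv_smooth_bounded_linear:
  "bounded_linear L \<Longrightarrow> smooth f \<Longrightarrow>
   partial_deriv a (\<lambda>y. L (f y)) = (\<lambda>y. L (partial_deriv a f y))"
  by (intro ext partial_deriv_bounded_linear smooth_differentiable)

lemma partial_deriv_smooth_diff:
  assumes "smooth f" "smooth g"
  shows "partial_deriv a (\<lambda>y. f y - g y) = (\<lambda>y. partial_deriv a f y - partial_deriv a g y)"
  using partial_deriv_smooth_add[OF assms(1) smooth_minus[OF assms(2)], of a]
    partial_deriv_smooth_bounded_linear[OF bounded_linear_minus[OF bounded_linear_ident] assms(2), of a]
  by simp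

section \<open>Integration over the torus\<close>

lemma periodicD:
  assumes "periodic f" "\<And>k. m $ k \<in> \<int>"
  shows "f (y + m) = f y"
  using assms unfolding periodic_def by blast

lemma periodic_partial:
  assumes "periodic f"
  shows "periodic (partial_deriv a f)"
  unfolding periodic_def
proof (intro allI impI)
  fix y m :: "real^'a" assume m: "\<forall>k. m $ k \<in> \<int>"
  have "(\<lambda>y. f (y + m)) = f" using periodicD[OF assms] m by auto
  then show "partial_deriv a f (y + m) = partial_deriv a f y"
    using partial_deriv_translate[of a f m] by metis
qed

lemma periodic_axis:
  assumes "periodic f"
  shows "f (y + axis a 1) = f y"
  by (rule periodicD[OF assms]) (auto simp: axis_def)

text \<open>Along the line \<open>f\<close> is affine with slope this derivative, and its values one
  period apart agree. Every later exclusion of an affine term rests on this.\<close>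

lemma partial_deriv_zero_of_line_const:
  fixes f :: "real^'n \<Rightarrow> 'b::real_normed_vector"
  assumes "periodic f" "\<And>y. f differentiable (at y)"
    and const: "\<And>s. partial_deriv a f (y + s *\<^sub>R axis a 1) = partial_deriv a f y"
  shows "partial_deriv a f y = 0"
proof -
  define d where "d = partial_deriv a f y"
  have "((\<lambda>s. f (y + s *\<^sub>R axis a 1) - s *\<^sub>R d) has_vector_derivative 0) (at s within UNIV)" for s
    using has_vector_derivative_partial_line[of f y s a] assms(2) const[of s]
    by (auto simp: d_def intro!: derivative_eq_intros)
  then obtain k where k: "\<And>s. f (y + s *\<^sub>R axis a 1) - s *\<^sub>R d = k"
    using has_vector_derivative_zero_constant[of UNIV "\<lambda>s. f (y + s *\<^sub>R axis a 1) - s *\<^sub>R d"] by auto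
  from k[of 0] k[of 1] periodic_axis[OF assms(1), of y a] show ?thesis
    by (simp add: d_def)
qed

lemma const_of_partial_zero:
  fixes f :: "real^'n \<Rightarrow> 'b::real_normed_vector"
  assumes "\<And>y. f differentiable (at y)" "\<And>a y. partial_deriv a f y = 0"
  shows "\<exists>k. \<forall>y. f y = k"
proof -
  have "(f has_derivative (\<lambda>v. 0)) (at y within UNIV)" for y
  proof -
    have lin: "linear (frechet_derivative f (at y))"
      using assms(1) linear_frechet_derivative by blast
    have "frechet_derivative f (at y) v = 0" for v
    proof -
      have "frechet_derivative f (at y) (\<Sum>i\<in>UNIV. (v $ i) *\<^sub>R axis i 1) = 0"
        using assms(2) by (simp add: linear_sum[OF lin] linear_scale[OF lin] frechet_partial[OF assms(1)])
      then show ?thesis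
        by (simp only: basis_expansion scalar_mult_eq_scaleR[symmetric])
    qed
    then have "frechet_derivative f (at y) = (\<lambda>v. 0)" by blast
    then show ?thesis using frechet_derivative_worksI[OF assms(1), of y] by simp
  qed
  then show ?thesis
    using has_derivative_zero_constant[of UNIV f] by auto
qed

definition pt :: "real \<Rightarrow> real \<Rightarrow> real^2"
  where "pt s t = s *\<^sub>R axis 1 1 + t *\<^sub>R axis 2 1"

lemma pt_nth [simp]: "pt s t $ 1 = s" "pt s t $ 2 = t"
  by (simp_all add: pt_def axis_def)

lemma pt_eta: "pt (y $ 1) (y $ 2) = y"
  by (simp add: vec_eq_iff forall_2)

lemma pt_line: "pt s 0 + t *\<^sub>R axis 2 1 = pt s t" "pt 0 t + s *\<^sub>R axis 1 1 = pt s t"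
  by (simp_all add: pt_def)

text \<open>Iterated, so that the fundamental theorem of calculus applies to the inner variable
  directly and to the outer one after a swap.\<close>

definition torus_integral :: "(real^2 \<Rightarrow> real) \<Rightarrow> real"
  where "torus_integral F = integral {0..1} (\<lambda>s. integral {0..1} (\<lambda>t. F (pt s t)))"

context
  fixes F :: "real^2 \<Rightarrow> real"
  assumes F: "continuous_on UNIV F"
begin

lemma pt_continuous: "continuous_on S (\<lambda>x. F (pt (f x) (g x)))"
  if "continuous_on S f" "continuous_on S g" for S :: "'c::topological_space set"
  by (rule continuous_on_compose2[OF F]) (auto simp: pt_def intro!: continuous_intros that)

lemma inner_integrable: "(\<lambda>t. F (pt s t)) integrable_on {0..1}"
  by (rule integrable_continuous_interval) (auto intro!: pt_continuous continuous_intros)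

lemma inner_continuous: "continuous_on {0..1} (\<lambda>s. integral {0..1} (\<lambda>t. F (pt s t)))"
proof -
  have "continuous_on (UNIV \<times> cbox 0 1) (\<lambda>(s, t). F (pt s t))"
    unfolding case_prod_unfold by (auto intro!: pt_continuous continuous_intros)
  from integral_continuous_on_param[OF this]
  have "continuous_on UNIV (\<lambda>s. integral {0..1} (\<lambda>t. F (pt s t)))" by simp
  then show ?thesis by (rule continuous_on_subset) simp
qed

lemma outer_integrable: "(\<lambda>s. integral {0..1} (\<lambda>t. F (pt s t))) integrable_on {0..1}"
  by (rule integrable_continuous_interval[OF inner_continuous])

lemma torus_integral_swap:
  "torus_integral F = integral {0..1} (\<lambda>t. integral {0..1} (\<lambda>s. F (pt s t)))"
proof -
  have "continuous_on (cbox (0, 0) (1, 1)) (\<lambda>(s, t). F (pt s t))"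
    unfolding case_prod_unfold by (auto intro!: pt_continuous continuous_intros)
  from integral_swap_continuous[OF this] show ?thesis
    by (simp add: torus_integral_def)
qed

text \<open>A nonnegative continuous function with zero integral vanishes. Used for the outer and
  then for the inner integral, this settles the unit square, and fractional parts carry
  \<open>y\<close> there.\<close>

lemma torus_integral_zero_imp:
  assumes "periodic F" "\<And>y. F y \<ge> 0" "torus_integral F = 0"
  shows "F y = 0"
proof -
  define s where "s = frac (y $ 1)"
  define t where "t = frac (y $ 2)"
  have st: "s \<in> {0..1}" "t \<in> {0..1}"
    using frac_lt_1[of "y $ 1"] frac_lt_1[of "y $ 2"] by (auto simp: s_def t_def)
  have "integral {0..1} (\<lambda>t. F (pt r t)) \<ge> 0" for r
    by (rule integral_nonneg[OF inner_integrable]) (rule assms(2))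
  then have "integral {0..1} (\<lambda>t. F (pt s t)) = 0"
    using integral_eq_0_iff[OF inner_continuous] assms(3) st(1)
    by (simp add: torus_integral_def)
  moreover have "continuous_on {0..1} (\<lambda>t. F (pt s t))"
    by (intro pt_continuous continuous_intros)
  ultimately have "F (pt s t) = 0"
    using integral_eq_0_iff[of 0 1 "\<lambda>t. F (pt s t)"] assms(2) st(2) by simp
  moreover have "F (pt s t + pt (of_int \<lfloor>y $ 1\<rfloor>) (of_int \<lfloor>y $ 2\<rfloor>)) = F (pt s t)"
  proof (rule periodicD[OF assms(1)])
    fix k :: 2
    show "pt (of_int \<lfloor>y $ 1\<rfloor>) (of_int \<lfloor>y $ 2\<rfloor>) $ k \<in> \<int>"
      using exhaust_2[of k] by auto
  qed
  moreover have "pt s t + pt (of_int \<lfloor>y $ 1\<rfloor>) (of_int \<lfloor>y $ 2\<rfloor>) = y"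
    by (simp add: vec_eq_iff forall_2 s_def t_def frac_def)
  ultimately show ?thesis by simp
qed

end

lemma torus_integral_add:
  assumes "continuous_on UNIV F" "continuous_on UNIV G"
  shows "torus_integral (\<lambda>y. F y + G y) = torus_integral F + torus_integral G"
  unfolding torus_integral_def
  by (simp add: integral_add[OF inner_integrable[OF assms(1)] inner_integrable[OF assms(2)]]
      integral_add[OF outer_integrable[OF assms(1)] outer_integrable[OF assms(2)]])

lemma torus_integral_partial:
  assumes "smooth g" "periodic g"
  shows "torus_integral (partial_deriv a g) = 0"
proof -
  have cont: "continuous_on UNIV (partial_deriv a g)"
    using assms(1) by (intro smooth_continuous smooth_partial)
  have diff: "g differentiable at y" for y
    using assms(1) by (rule smooth_differentiable)
  have *: "integral {0..1} (\<lambda>t. partial_deriv a g (y + t *\<^sub>R axis a 1)) = 0" for y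
  proof -
    have "((\<lambda>t. partial_deriv a g (y + t *\<^sub>R axis a 1)) has_integral
        g (y + 1 *\<^sub>R axis a 1) - g (y + 0 *\<^sub>R axis a 1)) {0..1}"
      by (rule fundamental_theorem_of_calculus)
        (auto intro: has_vector_derivative_partial_line[OF diff] has_vector_derivative_at_within)
    then show ?thesis using periodic_axis[OF assms(2), of y a] by (simp add: integral_unique)
  qed
  consider "a = 1" | "a = 2" using exhaust_2 by blast
  then show ?thesis
  proof cases
    case 1
    then have "integral {0..1} (\<lambda>s. partial_deriv a g (pt s t)) = 0" for t
      using *[of "pt 0 t"] by (simp add: pt_line)
    then show ?thesis by (simp add: torus_integral_swap[OF cont])
  next
    case 2
    then have "integral {0..1} (\<lambda>t. partial_deriv a g (pt s t)) = 0" for s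
      using *[of "pt s 0"] by (simp add: pt_line)
    then show ?thesis by (simp add: torus_integral_def)
  qed
qed

lemma periodic_comp2: "periodic f \<Longrightarrow> periodic g \<Longrightarrow> periodic (\<lambda>y. F (f y) (g y))"
  by (simp add: periodic_def)

lemma torus_integral_by_parts:
  assumes "smooth f" "periodic f" "smooth g" "periodic g"
  shows "torus_integral (\<lambda>y. f y * partial_deriv a g y) = - torus_integral (\<lambda>y. partial_deriv a f y * g y)"
proof -
  have "partial_deriv a (\<lambda>y. f y * g y) = (\<lambda>y. f y * partial_deriv a g y + partial_deriv a f y * g y)"
    using assms by (intro ext partial_deriv_mult smooth_differentiable)
  moreover have "torus_integral (partial_deriv a (\<lambda>y. f y * g y)) = 0"
    using assms by (intro torus_integral_partial smooth_mult periodic_comp2[of f g "(*)"])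
  moreover have "torus_integral (\<lambda>y. f y * partial_deriv a g y + partial_deriv a f y * g y) =
     torus_integral (\<lambda>y. f y * partial_deriv a g y) + torus_integral (\<lambda>y. partial_deriv a f y * g y)"
    using assms by (intro torus_integral_add smooth_continuous smooth_mult smooth_partial)
  ultimately show ?thesis by simp
qed

text \<open>The two derivatives move over in reverse order, so no symmetry of second partial
  derivatives is involved.\<close>

lemma torus_integral_by_parts2:
  assumes "smooth f" "periodic f" "smooth g" "periodic g"
  shows "torus_integral (\<lambda>y. f y * partial_deriv b (partial_deriv a g) y) =
    torus_integral (\<lambda>y. partial_deriv a (partial_deriv b f) y * g y)"
  using assms
  by (simp add: torus_integral_by_parts smooth_partial periodic_partial)

section \<open>Square roots of rank-one perturbations of the identity\<close>

lemmas entries_2 = vec_eq_iff forall_2 sum_2 matrix_matrix_mult_def matrix_vector_mult_def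
  vector_scalar_mult_def mat_def

text \<open>The hypothesis says that \<open>l\<close> is a root of the characteristic polynomial. A
  nonzero off-diagonal entry yields an explicit eigenvector; otherwise the matrix is
  diagonal.\<close>

lemma eigenvalue_2I:
  fixes S :: "complex^2^2"
  assumes "(S$1$1 - l) * (S$2$2 - l) = S$1$2 * S$2$1"
  shows "eigenvalue S l"
proof -
  have *: "eigenvalue S l" if "x \<noteq> 0 \<or> y \<noteq> 0" "S$1$1 * x + S$1$2 * y = l * x"
    "S$2$1 * x + S$2$2 * y = l * y" for x y
    unfolding eigenvalue_def using that
    by (intro exI[of _ "vector [x, y]"]) (auto simp: entries_2)
  consider "S$1$2 \<noteq> 0" | "S$2$1 \<noteq> 0" | "S$1$2 = 0" "S$2$1 = 0" by blast
  then show ?thesis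
  proof cases
    case 1
    show ?thesis
      by (rule *[of "S$1$2" "l - S$1$1"]) (use 1 assms in \<open>auto simp: algebra_simps\<close>)
  next
    case 2
    show ?thesis
      by (rule *[of "l - S$2$2" "S$2$1"]) (use 2 assms in \<open>auto simp: algebra_simps\<close>)
  next
    case 3
    then have "S$1$1 = l \<or> S$2$2 = l" using assms by auto
    then show ?thesis using *[of 1 0] *[of 0 1] 3 by auto
  qed
qed

text \<open>The quadratic formula over the complex numbers gives two roots of the characteristic
  polynomial. Both are eigenvalues, hence positive reals, and their sum and product are the trace
  and the determinant.\<close>

lemma trace_det_of_positive_eigenvalues:
  fixes S :: "complex^2^2"
  assumes "\<And>l. eigenvalue S l \<Longrightarrow> l \<in> \<real> \<and> 0 < Re l"
  obtains \<tau> \<delta> :: real where "\<tau> > 0" "\<delta> > 0"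
    "S$1$1 + S$2$2 = of_real \<tau>" "S$1$1 * S$2$2 - S$1$2 * S$2$1 = of_real \<delta>"
proof -
  define z where "z = csqrt ((S$1$1 - S$2$2)\<^sup>2 + 4 * S$1$2 * S$2$1)"
  have z: "z * z = (S$1$1 - S$2$2)\<^sup>2 + 4 * S$1$2 * S$2$1"
    by (metis z_def power2_csqrt power2_eq_square)
  define l1 l2 where "l1 = (S$1$1 + S$2$2 + z) / 2" and "l2 = (S$1$1 + S$2$2 - z) / 2"
  have "eigenvalue S l1" "eigenvalue S l2"
    by (rule eigenvalue_2I; use z in \<open>simp add: l1_def l2_def field_simps power2_eq_square\<close>)+
  then obtain r1 r2 where r: "l1 = of_real r1" "r1 > 0" "l2 = of_real r2" "r2 > 0"
    using assms by (metis Reals_cases Re_complex_of_real)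
  have "S$1$1 + S$2$2 = l1 + l2" "S$1$1 * S$2$2 - S$1$2 * S$2$1 = l1 * l2"
    using z by (simp_all add: l1_def l2_def field_simps power2_eq_square)
  with r that[of "r1 + r2" "r1 * r2"] show ?thesis by simp
qed

text \<open>By Cayley-Hamilton (tr S) S = S^2 + det S, so S^2 determines S once trace and
  determinant are known. The determinant is the positive root of det(S^2), the trace the positive
  root of tr(S^2) + 2 det S, and dividing by the positive trace is allowed.\<close>

lemma positive_sqrt_unique_2:
  fixes S T :: "complex^2^2"
  assumes "S ** S = T ** T"
    and S: "\<And>l. eigenvalue S l \<Longrightarrow> l \<in> \<real> \<and> 0 < Re l"
    and T: "\<And>l. eigenvalue T l \<Longrightarrow> l \<in> \<real> \<and> 0 < Re l"
  shows "S = T"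
proof -
  obtain t d where td: "t > 0" "d > 0"
    and trS: "S$1$1 + S$2$2 = complex_of_real t"
    and dS: "S$1$1 * S$2$2 - S$1$2 * S$2$1 = complex_of_real d"
    by (rule trace_det_of_positive_eigenvalues[OF S])
  obtain t' d' where td': "t' > 0" "d' > 0"
    and trT: "T$1$1 + T$2$2 = complex_of_real t'"
    and dT: "T$1$1 * T$2$2 - T$1$2 * T$2$1 = complex_of_real d'"
    by (rule trace_det_of_positive_eigenvalues[OF T])
  have sq: "S$1$1 * S$1$1 + S$1$2 * S$2$1 = T$1$1 * T$1$1 + T$1$2 * T$2$1"
    "S$1$1 * S$1$2 + S$1$2 * S$2$2 = T$1$1 * T$1$2 + T$1$2 * T$2$2"
    "S$2$1 * S$1$1 + S$2$2 * S$2$1 = T$2$1 * T$1$1 + T$2$2 * T$2$1"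
    "S$2$1 * S$1$2 + S$2$2 * S$2$2 = T$2$1 * T$1$2 + T$2$2 * T$2$2"
    using assms(1) by (simp_all add: entries_2)
  \<comment> \<open>The right-hand sides are written in the entries of the square of the matrix with
    rows (p, q) and (r, t), so that \<open>sq\<close> rewrites them for \<open>S\<close> and
    \<open>T\<close> alike.\<close>
  have det_sq: "(p * t - q * r)\<^sup>2 = (p * p + q * r) * (r * q + t * t) - (p * q + q * t) * (r * p + t * r)"
    and tr_sq: "(p + t)\<^sup>2 - 2 * (p * t - q * r) = (p * p + q * r) + (r * q + t * t)"
    and diff_sq: "(p - t) * (p + t) = (p * p + q * r) - (r * q + t * t)" for p q r t :: complex
    by (simp_all add: power2_eq_square algebra_simps)
  have "(S$1$1 * S$2$2 - S$1$2 * S$2$1)\<^sup>2 = (T$1$1 * T$2$2 - T$1$2 * T$2$1)\<^sup>2"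
    by (simp only: det_sq sq)
  then have "complex_of_real (d\<^sup>2) = complex_of_real (d'\<^sup>2)" by (simp only: dS dT of_real_power)
  then have "d\<^sup>2 = d'\<^sup>2" by (simp only: of_real_eq_iff)
  then have d: "d = d'" by (rule power2_eq_imp_eq) (use td(2) td'(2) in \<open>simp_all only: less_imp_le\<close>)
  have "(S$1$1 + S$2$2)\<^sup>2 - 2 * (S$1$1 * S$2$2 - S$1$2 * S$2$1) =
      (T$1$1 + T$2$2)\<^sup>2 - 2 * (T$1$1 * T$2$2 - T$1$2 * T$2$1)"
    by (simp only: tr_sq sq)
  then have "complex_of_real (t\<^sup>2) = complex_of_real (t'\<^sup>2)" by (simp add: dS dT trS trT d)
  then have "t\<^sup>2 = t'\<^sup>2" by (simp only: of_real_eq_iff)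
  then have t: "t = t'" by (rule power2_eq_imp_eq) (use td(1) td'(1) in \<open>simp_all only: less_imp_le\<close>)
  have nz: "complex_of_real t \<noteq> 0" using td(1) by simp
  have tr: "S$1$1 + S$2$2 = T$1$1 + T$2$2" using trS trT t by simp
  have "S$1$2 * (S$1$1 + S$2$2) = T$1$2 * (T$1$1 + T$2$2)"
    using sq(2) by (simp only: distrib_left mult.commute)
  then have "S$1$2 * complex_of_real t = T$1$2 * complex_of_real t" using trS trT t by simp
  then have 12: "S$1$2 = T$1$2" using nz by simp
  have "S$2$1 * (S$1$1 + S$2$2) = T$2$1 * (T$1$1 + T$2$2)"
    using sq(3) by (simp only: distrib_left mult.commute)
  then have "S$2$1 * complex_of_real t = T$2$1 * complex_of_real t" using trS trT t by simp
  then have 21: "S$2$1 = T$2$1" using nz by simp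
  have "(S$1$1 - S$2$2) * (S$1$1 + S$2$2) = (T$1$1 - T$2$2) * (T$1$1 + T$2$2)"
    using diff_sq[of "S$1$1" "S$2$2" "S$1$2" "S$2$1"] diff_sq[of "T$1$1" "T$2$2" "T$1$2" "T$2$1"]
    by (simp only: sq)
  then have "S$1$1 - S$2$2 = T$1$1 - T$2$2" using nz trS trT t by simp
  then have "(S$1$1 + S$2$2) + (S$1$1 - S$2$2) = (T$1$1 + T$2$2) + (T$1$1 - T$2$2)"
    "(S$1$1 + S$2$2) - (S$1$1 - S$2$2) = (T$1$1 + T$2$2) - (T$1$1 - T$2$2)" using tr by simp_all
  then have "S$1$1 = T$1$1" "S$2$2 = T$2$2" by simp_all
  then show ?thesis using 12 21 by (simp add: vec_eq_iff forall_2)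
qed

lemma matrix_sqrt_eqI:
  fixes S :: "complex^2^2"
  assumes "S ** S = A" "\<And>l. eigenvalue S l \<Longrightarrow> l \<in> \<real> \<and> 0 < Re l"
  shows "matrix_sqrt A = S"
  unfolding matrix_sqrt_def
proof (rule the_equality)
  show "S ** S = A \<and> (\<forall>l. eigenvalue S l \<longrightarrow> l \<in> \<real> \<and> 0 < Re l)"
    by (intro conjI allI impI assms(1)) (rule conjunct1[OF assms(2)] conjunct2[OF assms(2)], assumption)+
  fix T assume T: "T ** T = A \<and> (\<forall>l. eigenvalue T l \<longrightarrow> l \<in> \<real> \<and> 0 < Re l)"
  show "T = S"
  proof (rule positive_sqrt_unique_2)
    show "T ** T = S ** S" unfolding assms(1) using T ..
    show "l \<in> \<real> \<and> 0 < Re l" if "eigenvalue T l" for l using T that by blast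
    show "l \<in> \<real> \<and> 0 < Re l" if "eigenvalue S l" for l using assms(2) that .
  qed
qed

section \<open>Inverses and positive definiteness for 2 x 2 matrices\<close>

lemma matrix_inv_eqI:
  fixes A :: "'a::field^'n^'n"
  assumes "A ** B = mat 1"
  shows "matrix_inv A = B"
proof -
  have BA: "B ** A = mat 1" using assms matrix_left_right_inverse by blast
  then have "\<exists>A'. A ** A' = mat 1 \<and> A' ** A = mat 1" using assms by blast
  then have inv: "A ** matrix_inv A = mat 1 \<and> matrix_inv A ** A = mat 1"
    unfolding matrix_inv_def by (rule someI_ex)
  have "matrix_inv A = (B ** A) ** matrix_inv A" by (simp add: BA)
  also have "\<dots> = B" using inv by (simp add: matrix_mul_assoc[symmetric])
  finally show ?thesis .
qed

lemma pos_def_2D: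
  fixes H :: "real^2^2"
  assumes "pos_def H"
  shows "H$2$1 = H$1$2" "H$1$1 > 0" "H$2$2 > 0" "H$1$1 * H$2$2 - H$1$2 * H$1$2 > 0"
proof -
  show sym: "H$2$1 = H$1$2"
    using assms unfolding pos_def_def transpose_def vec_eq_iff by simp
  have q: "0 < x * (H$1$1 * x + H$1$2 * y) + y * (H$1$2 * x + H$2$2 * y)" if "x \<noteq> 0 \<or> y \<noteq> 0" for x y
    using assms that sym unfolding pos_def_def
    by (auto simp: entries_2 inner_vec_def dest!: spec[of _ "vector [x, y]"])
  show pos: "H$1$1 > 0" "H$2$2 > 0" using q[of 1 0] q[of 0 1] by simp_all
  \<comment> \<open>The vector (-H12, H11) is orthogonal to the first row, so the form takes the
    value H11 det H on it.\<close>
  have "0 < H$1$1 * (H$1$1 * H$2$2 - H$1$2 * H$1$2)"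
    using q[of "- (H$1$2)" "H$1$1"] pos by (simp add: algebra_simps)
  then show "H$1$1 * H$2$2 - H$1$2 * H$1$2 > 0"
    using pos by (simp add: zero_less_mult_iff)
qed

text \<open>In the index type \<open>2\<close> the term \<open>3 - a\<close> exchanges the two
  indices. Only the entry H12 occurs off the diagonal, so this is the inverse for symmetric
  \<open>H\<close>.\<close>

definition inv2 :: "real^2^2 \<Rightarrow> 2 \<Rightarrow> 2 \<Rightarrow> real"
  where "inv2 H a b = (if a = b then H$(3-a)$(3-a) else - H$1$2) / (H$1$1 * H$2$2 - H$1$2 * H$1$2)"

lemma inv2_simps:
  "inv2 H 1 1 = H$2$2 / (H$1$1 * H$2$2 - H$1$2 * H$1$2)"
  "inv2 H 2 2 = H$1$1 / (H$1$1 * H$2$2 - H$1$2 * H$1$2)"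
  "inv2 H 1 2 = - H$1$2 / (H$1$1 * H$2$2 - H$1$2 * H$1$2)"
  "inv2 H 2 1 = - H$1$2 / (H$1$1 * H$2$2 - H$1$2 * H$1$2)"
  by (simp_all add: inv2_def)

lemma matrix_inv_pos_def_2:
  assumes "pos_def H"
  shows "matrix_inv H = (\<chi> a b. inv2 H a b)"
    and "matrix_inv (map_matrix complex_of_real H) = map_matrix complex_of_real (\<chi> a b. inv2 H a b)"
proof -
  define D where "D = H$1$1 * H$2$2 - H$1$2 * H$1$2"
  have D: "D \<noteq> 0" using pos_def_2D(4)[OF assms] by (simp add: D_def)
  have *: "H ** (\<chi> a b. inv2 H a b) = mat 1"
    using pos_def_2D(1)[OF assms] D unfolding entries_2
    by (simp add: inv2_simps D_def[symmetric] field_simps)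
  then show "matrix_inv H = (\<chi> a b. inv2 H a b)" by (rule matrix_inv_eqI)
  have "map_matrix complex_of_real H ** map_matrix complex_of_real (\<chi> a b. inv2 H a b) =
      map_matrix complex_of_real (H ** (\<chi> a b. inv2 H a b))"
    by (simp add: entries_2 map_matrix_def)
  also have "\<dots> = mat 1" unfolding * by (simp add: entries_2 map_matrix_def)
  finally show "matrix_inv (map_matrix complex_of_real H) = map_matrix complex_of_real (\<chi> a b. inv2 H a b)"
    by (rule matrix_inv_eqI)
qed

text \<open>For \<open>\<xi> = \<kappa> w w\<^sup>T\<close> the endomorphism \<open>\<xi> H \<xi>' H\<close> is the rank-one matrix
  \<open>k h w v\<^sup>T\<close> with \<open>k = |\<kappa>|\<^sup>2\<close>, \<open>v = H w'\<close> and \<open>h = v\<^sup>T w\<close> (a prime denoting conjugation), so its only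
  possibly nonzero eigenvalue is \<open>k h\<^sup>2\<close>.\<close>

definition rank_one :: "complex \<Rightarrow> complex^2 \<Rightarrow> complex^2^2"
  where "rank_one \<kappa> w = (\<chi> a b. \<kappa> * w$a * w$b)"

text \<open>The imaginary part left out here is antisymmetric in \<open>a\<close> and
  \<open>b\<close> and cancels against symmetric matrices.\<close>

definition herm :: "complex^2 \<Rightarrow> 2 \<Rightarrow> 2 \<Rightarrow> real"
  where "herm w a b = Re (w$a * cnj (w$b))"

definition hval :: "real^2^2 \<Rightarrow> complex^2 \<Rightarrow> real"
  where "hval H w = H$1$1 * herm w 1 1 + 2 * H$1$2 * herm w 1 2 + H$2$2 * herm w 2 2"

definition endo :: "complex \<Rightarrow> complex^2 \<Rightarrow> real^2^2 \<Rightarrow> complex^2^2"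
  where "endo \<kappa> w H = rank_one \<kappa> w ** map_matrix complex_of_real H **
    map_matrix cnj (rank_one \<kappa> w) ** map_matrix complex_of_real H"

text \<open>For 0 < k h^2 \<le> 1 this is (1 - sqrt(1 - k h^2)) / h, rationalised so that it stays
  regular at h = 0. It is the coefficient of the rank-one term in the square root of 1 - k h w
  v^T.\<close>

definition bfun :: "real \<Rightarrow> real \<Rightarrow> real"
  where "bfun k h = k * h / (1 + sqrt (1 - k * h\<^sup>2))"

definition covec :: "real^2^2 \<Rightarrow> complex^2 \<Rightarrow> 2 \<Rightarrow> complex"
  where "covec H w b = cnj (w$1) * of_real (H$1$b) + cnj (w$2) * of_real (H$2$b)"

context
  fixes H :: "real^2^2" and w :: "complex^2" and \<kappa> :: complex
  assumes H: "pos_def H" and w: "w \<noteq> 0"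
begin

lemma covec_w: "covec H w 1 * w$1 + covec H w 2 * w$2 = of_real (hval H w)"
  using pos_def_2D(1)[OF H]
  by (simp add: covec_def hval_def herm_def complex_eq_iff algebra_simps)

text \<open>Completing the square: H11 h = |H11 w1 + H12 w2|^2 + (det H) |w2|^2.\<close>

lemma hval_pos: "hval H w > 0"
proof -
  note pd = pos_def_2D[OF H]
  define D where "D = H$1$1 * H$2$2 - H$1$2 * H$1$2"
  have D: "D > 0" using pd by (simp add: D_def)
  have eq: "H$1$1 * hval H w = (H$1$1 * Re (w$1) + H$1$2 * Re (w$2))\<^sup>2
      + (H$1$1 * Im (w$1) + H$1$2 * Im (w$2))\<^sup>2 + D * (Re (w$2) ^ 2 + Im (w$2) ^ 2)"
    by (simp add: hval_def herm_def D_def power2_eq_square algebra_simps)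
  have "H$1$1 * hval H w > 0"
  proof (cases "w$2 = 0")
    case True
    then have "Re (w$1) ^ 2 + Im (w$1) ^ 2 > 0"
      using w by (auto simp: vec_eq_iff forall_2 complex_eq_iff sum_power2_gt_zero_iff)
    then have "(H$1$1)\<^sup>2 * (Re (w$1) ^ 2 + Im (w$1) ^ 2) > 0" using pd by simp
    then show ?thesis unfolding eq using True by (simp add: power_mult_distrib distrib_left)
  next
    case False
    then have "Re (w$2) ^ 2 + Im (w$2) ^ 2 > 0"
      by (auto simp: complex_eq_iff sum_power2_gt_zero_iff)
    then have "D * (Re (w$2) ^ 2 + Im (w$2) ^ 2) > 0" using D by simp
    then show ?thesis unfolding eq by (simp add: add_nonneg_pos)
  qed
  then show ?thesis using pd by (simp add: zero_less_mult_iff)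
qed

lemma endo_eq: "endo \<kappa> w H = (\<chi> a b. of_real ((cmod \<kappa>)\<^sup>2 * hval H w) * w$a * covec H w b)"
proof -
  have "endo \<kappa> w H = (\<chi> a b. (\<kappa> * cnj \<kappa>) * (covec H w 1 * w$1 + covec H w 2 * w$2) * w$a * covec H w b)"
    using pos_def_2D(1)[OF H]
    by (simp add: endo_def rank_one_def covec_def entries_2 map_matrix_def algebra_simps)
  then show ?thesis unfolding covec_w complex_norm_square[symmetric] by simp
qed

lemma endo_mult_vec: "endo \<kappa> w H *v x =
    (of_real ((cmod \<kappa>)\<^sup>2 * hval H w) * (covec H w 1 * x$1 + covec H w 2 * x$2)) *s w"
  unfolding endo_eq by (simp add: entries_2 algebra_simps)

text \<open>The image lies in the line of \<open>w\<close>, and \<open>w\<close> itself is an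
  eigenvector. Pairing the eigenvector equation with \<open>covec\<close> gives l q = k h^2 q, where
  q = 0 forces l = 0.\<close>

lemma endo_eigenvalue:
  "eigenvalue (endo \<kappa> w H) l \<Longrightarrow> l = 0 \<or> l = of_real ((cmod \<kappa>)\<^sup>2 * (hval H w)\<^sup>2)"
  "eigenvalue (endo \<kappa> w H) (of_real ((cmod \<kappa>)\<^sup>2 * (hval H w)\<^sup>2))"
proof -
  let ?c = "of_real ((cmod \<kappa>)\<^sup>2 * hval H w) :: complex"
  note mv = endo_mult_vec
  show "eigenvalue (endo \<kappa> w H) (of_real ((cmod \<kappa>)\<^sup>2 * (hval H w)\<^sup>2))"
    unfolding eigenvalue_def mv using w
    by (intro exI[of _ w]) (simp add: covec_w power2_eq_square mult.assoc)
  assume "eigenvalue (endo \<kappa> w H) l"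
  then obtain x where x: "x \<noteq> 0" "(?c * (covec H w 1 * x$1 + covec H w 2 * x$2)) *s w = l *s x"
    unfolding eigenvalue_def mv by blast
  define q where "q = covec H w 1 * x$1 + covec H w 2 * x$2"
  have e: "?c * q * w$1 = l * x$1" "?c * q * w$2 = l * x$2"
    using x(2) unfolding q_def[symmetric] by (simp_all add: vec_eq_iff forall_2)
  have "l * q = covec H w 1 * (l * x$1) + covec H w 2 * (l * x$2)"
    by (simp add: q_def algebra_simps)
  also have "\<dots> = ?c * q * of_real (hval H w)"
    unfolding covec_w[symmetric] e[symmetric] by (simp add: algebra_simps)
  finally have "q = 0 \<or> l = of_real ((cmod \<kappa>)\<^sup>2 * (hval H w)\<^sup>2)"
    by (simp add: power2_eq_square algebra_simps)
  moreover have "l = 0" if "q = 0" using e x(1) that by (auto simp: vec_eq_iff forall_2)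
  ultimately show "l = 0 \<or> l = of_real ((cmod \<kappa>)\<^sup>2 * (hval H w)\<^sup>2)" by blast
qed

lemma spectral_radius_endo: "spectral_radius (endo \<kappa> w H) = (cmod \<kappa>)\<^sup>2 * (hval H w)\<^sup>2"
proof -
  let ?l = "(cmod \<kappa>)\<^sup>2 * (hval H w)\<^sup>2"
  let ?E = "cmod ` {l. eigenvalue (endo \<kappa> w H) l}"
  have sub: "{l. eigenvalue (endo \<kappa> w H) l} \<subseteq> {0, of_real ?l}"
    using endo_eigenvalue(1) by blast
  then have "finite ?E" by (intro finite_imageI) (erule finite_subset, simp)
  moreover have "x \<le> ?l" if "x \<in> ?E" for x
    using that sub by (auto simp: norm_mult norm_power)
  moreover have "?l \<in> ?E"
  proof (rule image_eqI)
    show "?l = cmod (of_real ?l)" by (subst norm_of_real) simp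
    show "of_real ?l \<in> {l. eigenvalue (endo \<kappa> w H) l}"
      using endo_eigenvalue(2) by blast
  qed
  ultimately show ?thesis unfolding spectral_radius_def by (intro Max_eqI) auto
qed

text \<open>The ansatz S = 1 - \<mu> w v^T has S^2 = 1 - \<mu> (2 - \<mu> h) w v^T, so \<mu> (2 -
  \<mu> h) = k h is needed. The solution with \<mu> h = 1 - s, s = sqrt(1 - k h^2), leaves only 1
  and s as possible eigenvalues, both positive.\<close>

lemma matrix_sqrt_endo:
  assumes "(cmod \<kappa>)\<^sup>2 * (hval H w)\<^sup>2 < 1"
  shows "matrix_sqrt (mat 1 - endo \<kappa> w H) =
    (\<chi> a b. mat 1 $ a $ b - of_real (bfun ((cmod \<kappa>)\<^sup>2) (hval H w)) * w$a * covec H w b)"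
proof -
  define k h where "k = (cmod \<kappa>)\<^sup>2" and "h = hval H w"
  define s \<mu> where "s = sqrt (1 - k * h\<^sup>2)" and "\<mu> = bfun k h"
  have s: "s > 0" "s\<^sup>2 = 1 - k * h\<^sup>2"
    using assms by (simp_all add: s_def k_def h_def)
  have s1: "1 + s \<noteq> 0" using s(1) by linarith
  have \<mu>s: "\<mu> * (1 + s) = k * h"
    unfolding \<mu>_def bfun_def s_def[symmetric] using s1 by (rule nonzero_eq_divide_eq[THEN iffD1]) simp
  have "\<mu> * h * (1 + s) = (1 - s) * (1 + s)"
  proof -
    have "\<mu> * h * (1 + s) = (\<mu> * (1 + s)) * h" by (simp only: mult_ac)
    also have "\<dots> = k * h\<^sup>2" unfolding \<mu>s by (simp only: power2_eq_square mult_ac)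
    also have "\<dots> = 1 - s\<^sup>2" using s(2) by linarith
    also have "\<dots> = (1 - s) * (1 + s)" by (simp add: power2_eq_square algebra_simps)
    finally show ?thesis .
  qed
  then have \<mu>h: "\<mu> * h = 1 - s" by (rule iffD1[OF mult_right_cancel[OF s1]])
  have \<mu>2: "\<mu> * (2 - \<mu> * h) = k * h" unfolding \<mu>h \<mu>s[symmetric] by simp
  define S :: "complex^2^2" where "S = (\<chi> a b. mat 1 $ a $ b - of_real \<mu> * w$a * covec H w b)"
  have cw: "covec H w 1 * w$1 + covec H w 2 * w$2 = of_real h" using covec_w by (simp add: h_def)
  have mv: "S *v x = x - (of_real \<mu> * (covec H w 1 * x$1 + covec H w 2 * x$2)) *s w" for x
    by (simp add: S_def entries_2 algebra_simps)
  have "(S ** S) *v x = (mat 1 - endo \<kappa> w H) *v x" for x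
  proof -
    define q where "q = covec H w 1 * x$1 + covec H w 2 * x$2"
    define r where "r = of_real \<mu> * q"
    have Sx: "S *v x = x - r *s w" by (simp only: mv q_def r_def)
    have "covec H w 1 * (S *v x)$1 + covec H w 2 * (S *v x)$2 = q - r * (covec H w 1 * w$1 + covec H w 2 * w$2)"
      by (simp add: Sx q_def right_diff_distrib distrib_left mult_ac)
    then have "(S ** S) *v x = S *v x - (of_real \<mu> * (q - r * of_real h)) *s w"
      unfolding matrix_vector_mul_assoc[symmetric] mv[of "S *v x"] cw by simp
    also have "\<dots> = x - (of_real (\<mu> * (2 - \<mu> * h)) * q) *s w"
      unfolding Sx by (simp add: vec_eq_iff r_def algebra_simps)
    also have "\<dots> = (mat 1 - endo \<kappa> w H) *v x"
      unfolding \<mu>2 matrix_vector_mult_diff_rdistrib matrix_vector_mul_lid endo_mult_vec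
      by (simp add: q_def k_def h_def)
    finally show ?thesis .
  qed
  then have "\<forall>x. (S ** S) *v x = (mat 1 - endo \<kappa> w H) *v x" ..
  then have sq: "S ** S = mat 1 - endo \<kappa> w H" by (rule iffD2[OF matrix_eq])
  have "l \<in> \<real> \<and> 0 < Re l" if "eigenvalue S l" for l
  proof -
    from that[unfolded eigenvalue_def] obtain x where x: "x \<noteq> 0" "S *v x = l *s x"
      by (elim exE conjE)
    define q where "q = covec H w 1 * x$1 + covec H w 2 * x$2"
    have e: "(1 - l) * x$1 = of_real \<mu> * q * w$1" "(1 - l) * x$2 = of_real \<mu> * q * w$2"
    proof -
      have "x$i - of_real \<mu> * q * w$i = l * x$i" for i
        using arg_cong[OF x(2), of "\<lambda>v. v $ i"] unfolding mv q_def[symmetric] by simp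
      then have "(1 - l) * x$i = x$i - (x$i - of_real \<mu> * q * w$i)" for i
        by (simp only: left_diff_distrib mult_1_left)
      then show "(1 - l) * x$1 = of_real \<mu> * q * w$1" "(1 - l) * x$2 = of_real \<mu> * q * w$2"
        by simp_all
    qed
    have "(1 - l) * q = covec H w 1 * ((1 - l) * x$1) + covec H w 2 * ((1 - l) * x$2)"
      by (simp add: q_def algebra_simps)
    also have "\<dots> = of_real \<mu> * q * (covec H w 1 * w$1 + covec H w 2 * w$2)"
      unfolding e by (simp add: algebra_simps)
    also have "\<dots> = of_real (1 - s) * q" unfolding cw \<mu>h[symmetric] by simp
    finally have "q = 0 \<or> l = of_real s" by auto
    moreover have "l = 1" if "q = 0" using e x(1) that by (auto simp: vec_eq_iff forall_2)
    ultimately show ?thesis using s(1) by auto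
  qed
  with sq have "matrix_sqrt (mat 1 - endo \<kappa> w H) = S" by (rule matrix_sqrt_eqI)
  then show ?thesis by (simp add: S_def \<mu>_def k_def h_def)
qed

text \<open>Since v = H w' with w' the conjugate of w, multiplying v^T by the inverse of H on the
  right restores the conjugate of w, and the correction to the inverse becomes Hermitian of rank
  one.\<close>

lemma sqrt_endo_inv:
  assumes "(cmod \<kappa>)\<^sup>2 * (hval H w)\<^sup>2 < 1"
  shows "(matrix_sqrt (mat 1 - endo \<kappa> w H) ** matrix_inv (map_matrix complex_of_real H)) $ a $ b =
    of_real (inv2 H a b) - of_real (bfun ((cmod \<kappa>)\<^sup>2) (hval H w)) * (w$a * cnj (w$b))"
proof -
  note pd = pos_def_2D[OF H]
  define D where "D = H$1$1 * H$2$2 - H$1$2 * H$1$2"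
  have "D \<noteq> 0" using pd by (simp add: D_def)
  then have D: "complex_of_real D \<noteq> 0" by simp
  have *: "covec H w 1 * of_real (inv2 H 1 b) + covec H w 2 * of_real (inv2 H 2 b) = cnj (w$b)" for b
  proof -
    have e: "covec H w 1 * of_real (H$2$2) - covec H w 2 * of_real (H$1$2) = cnj (w$1) * of_real D"
      "covec H w 2 * of_real (H$1$1) - covec H w 1 * of_real (H$1$2) = cnj (w$2) * of_real D"
      using pd(1) by (simp_all add: covec_def D_def algebra_simps)
    have "covec H w 1 * of_real (inv2 H 1 1) + covec H w 2 * of_real (inv2 H 2 1) =
        (covec H w 1 * of_real (H$2$2) - covec H w 2 * of_real (H$1$2)) / of_real D"
      by (simp add: inv2_simps D_def[symmetric] diff_divide_distrib)
    moreover have "covec H w 1 * of_real (inv2 H 1 2) + covec H w 2 * of_real (inv2 H 2 2) =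
        (covec H w 2 * of_real (H$1$1) - covec H w 1 * of_real (H$1$2)) / of_real D"
      by (simp add: inv2_simps D_def[symmetric] diff_divide_distrib)
    ultimately show ?thesis unfolding e using exhaust_2[of b] D by auto
  qed
  have "(matrix_sqrt (mat 1 - endo \<kappa> w H) ** matrix_inv (map_matrix complex_of_real H)) $ a $ b =
    of_real (inv2 H a b) - of_real (bfun ((cmod \<kappa>)\<^sup>2) (hval H w)) * w$a *
      (covec H w 1 * of_real (inv2 H 1 b) + covec H w 2 * of_real (inv2 H 2 b))"
  proof -
    have 1: "(if a = 1 then 1 else 0) * of_real (inv2 H 1 b) + (if a = 2 then 1 else 0) * of_real (inv2 H 2 b) =
        complex_of_real (inv2 H a b)"
      using exhaust_2[of a] by auto
    show ?thesis
      unfolding matrix_sqrt_endo[OF assms] matrix_inv_pos_def_2(2)[OF H] 1[symmetric]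
      by (simp add: matrix_matrix_mult_def sum_2 mat_def map_matrix_def left_diff_distrib distrib_left mult.assoc
          del: if_split)
  qed
  then show ?thesis unfolding * by (simp only: mult.assoc)
qed

end

section \<open>Monotonicity of the flux\<close>

lemma bfun_mono:
  assumes "k \<ge> 0" "0 \<le> h" "h \<le> h'" "k * h'\<^sup>2 < 1"
  shows "bfun k h \<le> bfun k h'"
proof -
  have "k * h\<^sup>2 \<le> k * h'\<^sup>2" using assms by (intro mult_left_mono power_mono)
  then have "sqrt (1 - k * h'\<^sup>2) \<le> sqrt (1 - k * h\<^sup>2)" by simp
  moreover have "k * h \<le> k * h'" using assms by (intro mult_left_mono)
  moreover have "0 < sqrt (1 - k * h'\<^sup>2)" using assms by simp
  moreover from this have "0 < 1 + sqrt (1 - k * h'\<^sup>2)" by linarith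
  ultimately show ?thesis unfolding bfun_def using assms
    by (intro frac_le) auto
qed

text \<open>With \<open>\<Delta> = H - K\<close> the sum is \<open>- tr (\<Delta> H\<^sup>-\<^sup>1 \<Delta> K\<^sup>-\<^sup>1)\<close>; clearing denominators and completing
  squares exhibits it as minus a sum of squares.\<close>
lemma inv2_monotone:
  assumes "pos_def H" "pos_def K"
  shows "(\<Sum>a\<in>UNIV. \<Sum>b\<in>UNIV. (H$a$b - K$a$b) * (inv2 H a b - inv2 K a b)) \<le> 0"
    and "(\<Sum>a\<in>UNIV. \<Sum>b\<in>UNIV. (H$a$b - K$a$b) * (inv2 H a b - inv2 K a b)) = 0 \<Longrightarrow> H = K"
proof -
  define b d p q r where "b = H$1$2" and "d = H$2$2" and "p = K$1$1" and "q = K$1$2" and "r = K$2$2"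
  define A B C where "A = H$1$1 - p" and "B = b - q" and "C = d - r"
  define D E where "D = H$1$1 * d - b * b" and "E = p * r - q * q"
  define X Y where "X = A * r - B * q" and "Y = B * r - C * q"
  note pd = pos_def_2D[OF assms(1)] pos_def_2D[OF assms(2)]
  have pos: "d > 0" "r > 0" "D > 0" "E > 0"
    using pd by (simp_all add: d_def r_def D_def E_def p_def q_def b_def)
  let ?S = "\<Sum>a\<in>UNIV. \<Sum>b\<in>UNIV. (H$a$b - K$a$b) * (inv2 H a b - inv2 K a b)"
  define i j where "i = inverse D" and "j = inverse E"
  have inv2: "inv2 H 1 1 = d * i" "inv2 H 1 2 = - b * i" "inv2 H 2 1 = - b * i" "inv2 H 2 2 = H$1$1 * i"
    "inv2 K 1 1 = r * j" "inv2 K 1 2 = - q * j" "inv2 K 2 1 = - q * j" "inv2 K 2 2 = p * j"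
    by (simp_all add: inv2_simps D_def E_def b_def d_def p_def q_def r_def i_def j_def divide_inverse)
  have "?S = A * (d / D - r / E) - 2 * B * (b / D - q / E) + C * (H$1$1 / D - p / E)"
    using pd by (simp add: sum_2 inv2 A_def B_def C_def b_def d_def p_def q_def r_def
        divide_inverse i_def[symmetric] j_def[symmetric] algebra_simps)
  also have "\<dots> * (D * E) = A * (d * E - r * D) - 2 * B * (b * E - q * D) + C * (H$1$1 * E - p * D)"
    using pos by (simp add: field_simps)
  \<comment> \<open>With e = (0, 1) and k = (r, -q) one has r adj K = k k^T + E e e^T, while
    \<Delta> k = (X, Y) and \<Delta> e = (B, C). The factor d then completes the square in the form
    of adj H, since d z^T (adj H) z = (d z1 - b z2)^2 + D z2^2.\<close>
  finally have "d * r * (?S * (D * E)) =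
      d * r * (A * (d * E - r * D) - 2 * B * (b * E - q * D) + C * (H$1$1 * E - p * D))" by simp
  also have "\<dots> = - ((d * X - b * Y)\<^sup>2 + D * Y\<^sup>2 + E * ((d * B - b * C)\<^sup>2 + D * C\<^sup>2))"
    by (simp add: A_def B_def C_def D_def E_def X_def Y_def power2_eq_square algebra_simps)
  finally have eq: "?S * (d * r * D * E) =
      - ((d * X - b * Y)\<^sup>2 + D * Y\<^sup>2 + E * ((d * B - b * C)\<^sup>2 + D * C\<^sup>2))"
    by (simp add: mult_ac)
  have c: "d * r * D * E > 0" using pos by simp
  have nn: "0 \<le> D * Y\<^sup>2" "0 \<le> E * ((d * B - b * C)\<^sup>2 + D * C\<^sup>2)" "0 \<le> D * C\<^sup>2"
    using pos by simp_all
  have le: "?S * (d * r * D * E) \<le> 0" unfolding eq using nn zero_le_power2[of "d * X - b * Y"] by linarith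
  show "?S \<le> 0"
  proof (rule ccontr)
    assume "\<not> ?S \<le> 0"
    then have "?S > 0" by linarith
    from mult_pos_pos[OF this c] le show False by linarith
  qed
  assume "?S = 0"
  with eq have z: "(d * X - b * Y)\<^sup>2 + D * Y\<^sup>2 + E * ((d * B - b * C)\<^sup>2 + D * C\<^sup>2) = 0" by simp
  then have "(d * X - b * Y)\<^sup>2 = 0" "E * ((d * B - b * C)\<^sup>2 + D * C\<^sup>2) = 0"
    using nn zero_le_power2[of "d * X - b * Y"] by linarith+
  moreover have "D * Y\<^sup>2 = 0" using z nn zero_le_power2[of "d * X - b * Y"] by linarith
  ultimately have "Y = 0" "d * X = b * Y" "(d * B - b * C)\<^sup>2 + D * C\<^sup>2 = 0" using pos by auto
  moreover from this(3) have "D * C\<^sup>2 = 0" "(d * B - b * C)\<^sup>2 = 0"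
    using nn(3) zero_le_power2[of "d * B - b * C"] by linarith+
  ultimately have "C = 0" "B = 0" "X = 0" using pos by auto
  moreover from this have "A = 0" using pos by (simp add: X_def)
  ultimately show "H = K"
    using pd by (simp add: vec_eq_iff forall_2 A_def B_def C_def b_def d_def p_def q_def r_def)
qed

text \<open>The real part of \<open>(1 - \<xi> H \<xi>' H)\<^sup>1\<^sup>/\<^sup>2 H\<^sup>-\<^sup>1\<close>.\<close>
definition flux :: "complex \<Rightarrow> complex^2 \<Rightarrow> real^2^2 \<Rightarrow> 2 \<Rightarrow> 2 \<Rightarrow> real"
  where "flux \<kappa> w H a b = inv2 H a b - bfun ((cmod \<kappa>)\<^sup>2) (hval H w) * herm w a b"

text \<open>\<open>hval\<close> is linear in the matrix with coefficients \<open>herm\<close>, so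
  the second term of the flux contributes -(h(H) - h(K)) times the increment of \<open>bfun\<close>,
  which is nonpositive because \<open>bfun\<close> increases. Strictness comes from the inverse
  alone.\<close>

lemma flux_monotone:
  assumes "pos_def H" "pos_def K" "w \<noteq> 0"
    and lam: "(cmod \<kappa>)\<^sup>2 * (hval H w)\<^sup>2 < 1" "(cmod \<kappa>)\<^sup>2 * (hval K w)\<^sup>2 < 1"
  shows "(\<Sum>a\<in>UNIV. \<Sum>b\<in>UNIV. (H$a$b - K$a$b) * (flux \<kappa> w H a b - flux \<kappa> w K a b)) \<le> 0"
    and "(\<Sum>a\<in>UNIV. \<Sum>b\<in>UNIV. (H$a$b - K$a$b) * (flux \<kappa> w H a b - flux \<kappa> w K a b)) = 0 \<Longrightarrow> H = K"
proof -
  let ?S = "\<Sum>a\<in>UNIV. \<Sum>b\<in>UNIV. (H$a$b - K$a$b) * (inv2 H a b - inv2 K a b)"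
  let ?B = "\<lambda>H. bfun ((cmod \<kappa>)\<^sup>2) (hval H w)"
  have "herm w 2 1 = herm w 1 2" by (simp add: herm_def)
  then have eq: "(\<Sum>a\<in>UNIV. \<Sum>b\<in>UNIV. (H$a$b - K$a$b) * (flux \<kappa> w H a b - flux \<kappa> w K a b)) =
      ?S - (hval H w - hval K w) * (?B H - ?B K)"
    using pos_def_2D(1)[OF assms(1)] pos_def_2D(1)[OF assms(2)]
    by (simp add: sum_2 flux_def hval_def algebra_simps)
  have "(hval H w - hval K w) * (?B H - ?B K) \<ge> 0"
    using bfun_mono[of "(cmod \<kappa>)\<^sup>2" "hval H w" "hval K w"] bfun_mono[of "(cmod \<kappa>)\<^sup>2" "hval K w" "hval H w"]
      lam hval_pos[OF assms(1,3)] hval_pos[OF assms(2,3)]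
    by (cases "hval H w \<le> hval K w") (auto simp: zero_le_mult_iff)
  then show "(\<Sum>a\<in>UNIV. \<Sum>b\<in>UNIV. (H$a$b - K$a$b) * (flux \<kappa> w H a b - flux \<kappa> w K a b)) \<le> 0"
    and "(\<Sum>a\<in>UNIV. \<Sum>b\<in>UNIV. (H$a$b - K$a$b) * (flux \<kappa> w H a b - flux \<kappa> w K a b)) = 0 \<Longrightarrow> H = K"
    using inv2_monotone[OF assms(1,2)] unfolding eq by linarith+
qed

section \<open>Symplectic potentials, their Hessians and translates\<close>

lemma smooth_of_partials:
  assumes "\<And>y. f differentiable (at y)" "\<And>a. smooth (partial_deriv a f)"
  shows "smooth f"
  using assms by (intro smooth_bootstrap) (simp_all add: smooth_iff_upto)

lemma partial_deriv_coordinate: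
  "partial_deriv b (\<lambda>y::real^'n. y $ a) = (\<lambda>y. if b = a then 1 else 0)"
proof
  fix y :: "real^'n"
  have "((\<lambda>y. y $ a) has_derivative (\<lambda>v. v $ a)) (at y)"
    by (intro bounded_linear_imp_has_derivative bounded_linear_vec_nth)
  from partial_deriv_eqI[OF this, of b]
  show "partial_deriv b (\<lambda>y. y $ a) y = (if b = a then 1 else 0)" by (simp add: axis_def)
qed

lemma smooth_coordinate [smooth_intros]: "smooth (\<lambda>y. y $ a)"
proof (rule smooth_of_partials)
  show "smooth (partial_deriv b (\<lambda>y. y $ a))" for b
    unfolding partial_deriv_coordinate by (rule smooth_const)
  show "(\<lambda>y. y $ a) differentiable at y" for y
    by (intro bounded_linear_imp_differentiable bounded_linear_vec_nth)
qed

lemma has_derivative_u0: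
  fixes y :: "real^'n"
  shows "(u0 has_derivative (\<lambda>v. y \<bullet> v)) (at y)"
proof -
  have "u0 = (\<lambda>y::real^'n. (y \<bullet> y) / 2)" by (simp add: fun_eq_iff u0_def dot_square_norm)
  moreover have "((\<lambda>y. (y \<bullet> y) / 2) has_derivative (\<lambda>v. y \<bullet> v)) (at y)"
    by (auto intro!: derivative_eq_intros simp: inner_commute)
  ultimately show ?thesis by simp
qed

lemma partial_deriv_u0: "partial_deriv a u0 = (\<lambda>y. y $ a)"
  by (rule ext, subst partial_deriv_eqI[OF has_derivative_u0]) (simp add: inner_axis)

lemma smooth_u0: "smooth (u0 :: real^'n::finite \<Rightarrow> real)"
proof (rule smooth_of_partials)
  show "u0 differentiable at y" for y :: "real^'n::finite"
    using has_derivative_u0 by (rule differentiableI)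
  show "smooth (partial_deriv a u0)" for a :: 'n
    unfolding partial_deriv_u0 by (rule smooth_coordinate)
qed

lemma smooth_translate: "smooth f \<Longrightarrow> smooth (\<lambda>y. f (y + z))"
proof -
  have fold: "fold partial_deriv as (\<lambda>y. f (y + z)) = (\<lambda>y. fold partial_deriv as f (y + z))" for as f
    by (induction as arbitrary: f) (simp_all add: partial_deriv_translate)
  assume "smooth f"
  then have D: "fold partial_deriv as f differentiable at (y + z)" for as y
    unfolding smooth_def by blast
  have transl: "(\<lambda>y. g (y + z)) differentiable at y" if "g differentiable at (y + z)" for g y
  proof -
    obtain g' where "(g has_derivative g') (at (y + z))"
      using \<open>g differentiable at (y + z)\<close> unfolding differentiable_def by blast
    moreover have "((\<lambda>y. y + z) has_derivative (\<lambda>v. v)) (at y)"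
      by (auto intro!: derivative_eq_intros)
    ultimately have "(g \<circ> (\<lambda>y. y + z) has_derivative g' \<circ> (\<lambda>v. v)) (at y)"
      by (intro diff_chain_at)
    then show ?thesis unfolding o_def by (rule differentiableI)
  qed
  show ?thesis unfolding smooth_def fold by (intro allI transl D)
qed

lemma hessian_u0_add:
  assumes "smooth \<phi>"
  shows "hessian (\<lambda>y. u0 y + \<phi> y) y $ a $ b = (if b = a then 1 else 0) + partial_deriv b (partial_deriv a \<phi>) y"
  using assms
  by (simp add: hessian_def partial_deriv_smooth_add smooth_u0 partial_deriv_u0 smooth_coordinate
      smooth_partial partial_deriv_coordinate)

context
  fixes u :: "real^'n \<Rightarrow> real"
  assumes u: "symplectic_potential u"
begin

lemma potential_smooth: "smooth u"
  using u smooth_add[OF smooth_u0] unfolding symplectic_potential_def by blast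

lemma potential_pos_def: "pos_def (hessian u y)"
  using u unfolding symplectic_potential_def by blast

lemma hessian_smooth: "smooth (\<lambda>y. hessian u y $ a $ b)"
  by (simp add: hessian_def smooth_partial potential_smooth)

lemma potential_obtain:
  obtains \<phi> where "smooth \<phi>" "periodic \<phi>" "u = (\<lambda>y. u0 y + \<phi> y)"
    "\<And>y a b. hessian u y $ a $ b = (if b = a then 1 else 0) + partial_deriv b (partial_deriv a \<phi>) y"
proof -
  obtain \<phi> where \<phi>: "smooth \<phi>" "periodic \<phi>" "u = (\<lambda>y. u0 y + \<phi> y)"
    using u unfolding symplectic_potential_def by blast
  then show ?thesis using that[OF \<phi>] hessian_u0_add[OF \<phi>(1)] by blast
qed

lemma hessian_periodic: "periodic (hessian u)"
proof -
  obtain \<phi> where \<phi>: "smooth \<phi>" "periodic \<phi>"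
    "\<And>y a b. hessian u y $ a $ b = (if b = a then 1 else 0) + partial_deriv b (partial_deriv a \<phi>) y"
    by (rule potential_obtain) blast
  have "periodic (partial_deriv b (partial_deriv a \<phi>))" for a b
    using \<phi>(2) by (intro periodic_partial)
  then show ?thesis by (simp add: periodic_def vec_eq_iff \<phi>(3))
qed

text \<open>A translate of \<open>u\<close> is a potential only up to an affine function.\<close>
lemma potential_translate:
  obtains v where "symplectic_potential v" "\<And>y. hessian v y = hessian u (y + z)"
proof -
  obtain \<phi> where \<phi>: "smooth \<phi>" "periodic \<phi>"
    "\<And>y a b. hessian u y $ a $ b = (if b = a then 1 else 0) + partial_deriv b (partial_deriv a \<phi>) y"
    by (rule potential_obtain) blast
  define v where "v = (\<lambda>y. u0 y + \<phi> (y + z))"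
  have sm: "smooth (\<lambda>y. \<phi> (y + z))" using \<phi>(1) by (rule smooth_translate)
  have per: "periodic (\<lambda>y. \<phi> (y + z))"
    unfolding periodic_def
  proof (intro allI impI)
    fix y m :: "real^'n" assume m: "\<forall>k. m $ k \<in> \<int>"
    have "\<phi> ((y + z) + m) = \<phi> (y + z)" using m by (intro periodicD[OF \<phi>(2)]) blast
    then show "\<phi> (y + m + z) = \<phi> (y + z)" by (simp only: add_ac)
  qed
  have hess: "hessian v y = hessian u (y + z)" for y
    unfolding vec_eq_iff \<phi>(3) v_def hessian_u0_add[OF sm] by (simp add: partial_deriv_translate)
  then have "symplectic_potential v"
    unfolding symplectic_potential_def using sm per potential_pos_def v_def by auto
  then show ?thesis using hess that by blast
qed

end

lemma hessian_add_const:
  assumes "smooth u"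
  shows "hessian (\<lambda>y. u y + k) = hessian u"
  by (simp add: hessian_def fun_eq_iff partial_deriv_smooth_add[OF assms smooth_const])

section \<open>Uniqueness of solutions\<close>

lemma smooth_sum [smooth_intros]:
  "(\<And>i. i \<in> I \<Longrightarrow> smooth (f i)) \<Longrightarrow> smooth (\<lambda>y. \<Sum>i\<in>I. f i y)"
  by (induction I rule: infinite_finite_induct) (simp_all add: smooth_const smooth_add)

lemma torus_integral_sum:
  assumes "\<And>i. smooth (f i)"
  shows "torus_integral (\<lambda>y. \<Sum>i\<in>I. f i y) = (\<Sum>i\<in>I. torus_integral (f i))"
proof (induction I rule: infinite_finite_induct)
  case (insert i I)
  have "torus_integral (\<lambda>y. f i y + (\<Sum>i\<in>I. f i y)) =
      torus_integral (f i) + torus_integral (\<lambda>y. \<Sum>i\<in>I. f i y)"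
    using assms by (intro torus_integral_add smooth_continuous smooth_sum)
  with insert show ?case by simp
qed (simp_all add: torus_integral_def)

text \<open>Treats both cases at once. Keeping the scalar \<open>\<kappa>\<close> separate from the
  nowhere vanishing \<open>w\<close> avoids a square root of \<open>\<kappa>\<close>, which need not
  be smooth where \<xi>^22 vanishes in case (i).\<close>

locale rank_one_higgs =
  fixes \<kappa> :: "real^2 \<Rightarrow> complex" and w :: "real^2 \<Rightarrow> complex^2" and \<xi> :: "real^2 \<Rightarrow> complex^2^2"
  assumes xi_eq: "\<xi> y = rank_one (\<kappa> y) (w y)"
    and smooth_kappa: "smooth \<kappa>"
    and smooth_w: "smooth (\<lambda>y. w y $ a)"
    and periodic_kappa: "periodic \<kappa>"
    and periodic_w: "periodic w"
    and w_nonzero: "w y \<noteq> 0"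
begin

abbreviation moment_matrix :: "(real^2 \<Rightarrow> real) \<Rightarrow> real^2 \<Rightarrow> complex^2^2"
  where "moment_matrix u y \<equiv> matrix_sqrt (mat 1 - higgs_endo \<xi> u y) ** matrix_inv (hessian_c u y)"

lemma higgs_endo_eq: "higgs_endo \<xi> u y = endo (\<kappa> y) (w y) (hessian u y)"
  by (simp add: higgs_endo_def endo_def xi_eq)

lemma admissible_iff:
  assumes "symplectic_potential u"
  shows "admissible \<xi> u \<longleftrightarrow> (\<forall>y. (cmod (\<kappa> y))\<^sup>2 * (hval (hessian u y) (w y))\<^sup>2 < 1)"
  unfolding admissible_def higgs_endo_eq
  by (simp only: spectral_radius_endo[OF potential_pos_def[OF assms] w_nonzero])

context
  fixes u :: "real^2 \<Rightarrow> real"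
  assumes u: "symplectic_potential u"
    and adm: "(cmod (\<kappa> y))\<^sup>2 * (hval (hessian u y) (w y))\<^sup>2 < 1"
begin

lemma moment_matrix_nth: "moment_matrix u y $ a $ b = of_real (inv2 (hessian u y) a b) -
    of_real (bfun ((cmod (\<kappa> y))\<^sup>2) (hval (hessian u y) (w y))) * (w y $ a * cnj (w y $ b))"
  unfolding higgs_endo_eq
  by (rule sqrt_endo_inv[OF potential_pos_def[OF u] w_nonzero adm])

lemma Re_moment_matrix: "Re (moment_matrix u y $ a $ b) = flux (\<kappa> y) (w y) (hessian u y) a b"
  unfolding moment_matrix_nth flux_def herm_def by simp

lemma moment_matrix_smooth: "smooth (\<lambda>y. moment_matrix u y $ a $ b)"
proof -
  note H = hessian_smooth[OF u]
  have herm: "smooth (\<lambda>y. herm (w y) a b)" for a b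
    unfolding herm_def by (intro smooth_intros smooth_w)
  have k: "smooth (\<lambda>y. (cmod (\<kappa> y))\<^sup>2)"
  proof -
    have "(\<lambda>y. (cmod (\<kappa> y))\<^sup>2) = (\<lambda>y. Re (\<kappa> y * cnj (\<kappa> y)))"
      by (intro ext) (simp add: complex_mult_cnj cmod_power2)
    then show ?thesis by (simp only:) (intro smooth_intros smooth_kappa)
  qed
  have h: "smooth (\<lambda>y. hval (hessian u y) (w y))"
    unfolding hval_def by (intro smooth_intros H herm)
  \<comment> \<open>Strictness of admissibility enters here: the square root is smooth only where
    its argument is positive.\<close>
  have pos: "0 < 1 - (cmod (\<kappa> y))\<^sup>2 * (hval (hessian u y) (w y) * hval (hessian u y) (w y))" for y
    using adm[of y] by (simp add: power2_eq_square)
  have "1 + sqrt (1 - (cmod (\<kappa> y))\<^sup>2 * (hval (hessian u y) (w y) * hval (hessian u y) (w y))) \<noteq> 0" for y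
    using real_sqrt_gt_zero[OF pos[of y]] by linarith
  then have b: "smooth (\<lambda>y. bfun ((cmod (\<kappa> y))\<^sup>2) (hval (hessian u y) (w y)))"
    unfolding bfun_def power2_eq_square[of "hval _ _"] by (intro smooth_intros k h pos)
  have det: "hessian u y $ 1 $ 1 * hessian u y $ 2 $ 2 - hessian u y $ 1 $ 2 * hessian u y $ 1 $ 2 \<noteq> 0" for y
    using pos_def_2D(4)[OF potential_pos_def[OF u], of y] by linarith
  have inv: "smooth (\<lambda>y. inv2 (hessian u y) a b)"
    unfolding inv2_def
  proof (rule smooth_divide[OF _ _ det])
    show "smooth (\<lambda>y. if a = b then hessian u y $ (3 - a) $ (3 - a) else - hessian u y $ 1 $ 2)"
      by (cases "a = b") (simp_all add: smooth_minus H)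
  qed (intro smooth_intros H)
  show ?thesis unfolding moment_matrix_nth by (intro smooth_intros inv b smooth_w)
qed

lemma moment_matrix_periodic: "periodic (\<lambda>y. moment_matrix u y $ a $ b)"
  unfolding moment_matrix_nth
  using hessian_periodic[OF u] periodic_kappa periodic_w by (simp add: periodic_def)

end

lemma solution_hessian_unique:
  assumes "solves_real_moment_map \<xi> u" "solves_real_moment_map \<xi> v"
  shows "hessian u y = hessian v y"
proof -
  have u: "symplectic_potential u" "admissible \<xi> u" "\<And>y. div2 (moment_matrix u) y = 0"
    and v: "symplectic_potential v" "admissible \<xi> v" "\<And>y. div2 (moment_matrix v) y = 0"
    using assms unfolding solves_real_moment_map_def by simp_all
  have uadm: "(cmod (\<kappa> y))\<^sup>2 * (hval (hessian u y) (w y))\<^sup>2 < 1" for y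
    using u(2) unfolding admissible_iff[OF u(1)] by simp
  have vadm: "(cmod (\<kappa> y))\<^sup>2 * (hval (hessian v y) (w y))\<^sup>2 < 1" for y
    using v(2) unfolding admissible_iff[OF v(1)] by simp
  note sm = moment_matrix_smooth[OF u(1) uadm] moment_matrix_smooth[OF v(1) vadm]
  note per = moment_matrix_periodic[OF u(1) uadm] moment_matrix_periodic[OF v(1) vadm]
  \<comment> \<open>Real parts suffice, because the test function \<open>d\<close> below is
    real.\<close>
  define G where "G a b y = Re (moment_matrix u y $ a $ b) - Re (moment_matrix v y $ a $ b)" for a b y
  have G_smooth: "smooth (G a b)" for a b
    unfolding G_def by (intro smooth_intros sm)
  have G_periodic: "periodic (G a b)" for a b
    using per[of a b] unfolding G_def periodic_def by simp
  have G_flux: "G a b y = flux (\<kappa> y) (w y) (hessian u y) a b - flux (\<kappa> y) (w y) (hessian v y) a b" for a b y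
    unfolding G_def Re_moment_matrix[OF u(1) uadm] Re_moment_matrix[OF v(1) vadm] by (rule refl)
  have G_div: "(\<Sum>a\<in>UNIV. \<Sum>b\<in>UNIV. partial_deriv b (partial_deriv a (G a b)) y) = 0" for y
  proof -
    have "partial_deriv b (partial_deriv a (G a b)) y =
        Re (partial_deriv b (partial_deriv a (\<lambda>y. moment_matrix u y $ a $ b)) y) -
        Re (partial_deriv b (partial_deriv a (\<lambda>y. moment_matrix v y $ a $ b)) y)" for a b
      unfolding G_def
      by (simp add: partial_deriv_smooth_diff partial_deriv_smooth_bounded_linear[OF bounded_linear_Re]
          smooth_Re smooth_partial sm)
    then have "(\<Sum>a\<in>UNIV. \<Sum>b\<in>UNIV. partial_deriv b (partial_deriv a (G a b)) y) =
        Re (div2 (moment_matrix u) y) - Re (div2 (moment_matrix v) y)"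
      by (simp add: div2_def sum_subtractf)
    then show ?thesis using u(3) v(3) by simp
  qed
  obtain \<phi> where \<phi>: "smooth \<phi>" "periodic \<phi>"
    "\<And>y a b. hessian u y $ a $ b = (if b = a then 1 else 0) + partial_deriv b (partial_deriv a \<phi>) y"
    using u(1) by (rule potential_obtain) blast
  obtain \<psi> where \<psi>: "smooth \<psi>" "periodic \<psi>"
    "\<And>y a b. hessian v y $ a $ b = (if b = a then 1 else 0) + partial_deriv b (partial_deriv a \<psi>) y"
    using v(1) by (rule potential_obtain) blast
  define d where "d = (\<lambda>y. \<phi> y - \<psi> y)"
  have d_smooth: "smooth d" unfolding d_def by (intro smooth_intros \<phi> \<psi>)
  have d_periodic: "periodic d" using \<phi>(2) \<psi>(2) unfolding d_def periodic_def by simp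
  have d_hess: "partial_deriv b (partial_deriv a d) y = hessian u y $ a $ b - hessian v y $ a $ b" for a b y
    unfolding d_def \<phi>(3) \<psi>(3)
    by (simp add: partial_deriv_smooth_diff smooth_partial \<phi> \<psi>)
  \<comment> \<open>This symmetry supplies the exchange of derivatives of \<open>d\<close> that
    matches the reversed order in \<open>torus_integral_by_parts2\<close>.\<close>
  have sym: "hessian u y $ b $ a - hessian v y $ b $ a = hessian u y $ a $ b - hessian v y $ a $ b" for a b y
    using pos_def_2D(1)[OF potential_pos_def[OF u(1)], of y] pos_def_2D(1)[OF potential_pos_def[OF v(1)], of y]
      exhaust_2[of a] exhaust_2[of b] by auto
  define E where "E y = (\<Sum>a\<in>UNIV. \<Sum>b\<in>UNIV. (hessian u y $ a $ b - hessian v y $ a $ b) * G a b y)" for y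
  have pd: "pos_def (hessian u y)" "pos_def (hessian v y)" for y
    using u(1) v(1) by (auto intro: potential_pos_def)
  note mono = flux_monotone[OF pd w_nonzero uadm vadm, folded G_flux, folded E_def]
  have hs: "smooth (\<lambda>y. hessian u y $ a $ b - hessian v y $ a $ b)" for a b
    by (intro smooth_intros hessian_smooth u(1) v(1))
  have E_smooth: "smooth E"
    unfolding E_def by (intro smooth_intros hs G_smooth)
  have E_periodic: "periodic E"
    using G_periodic hessian_periodic[OF u(1)] hessian_periodic[OF v(1)]
    unfolding E_def periodic_def by simp
  \<comment> \<open>\<open>E\<close> \<le> 0 pointwise by monotonicity. Moving both derivatives from
    \<open>d\<close> to \<open>G\<close> produces the vanishing double divergence, so
    \<open>E\<close> integrates to 0 and must vanish, which is the equality case.\<close>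
  have "torus_integral E = (\<Sum>a\<in>UNIV. \<Sum>b\<in>UNIV. torus_integral (\<lambda>y. partial_deriv a (partial_deriv b d) y * G a b y))"
    unfolding E_def d_hess sym
    by (simp add: torus_integral_sum smooth_sum smooth_mult hs G_smooth)
  also have "\<dots> = (\<Sum>a\<in>UNIV. \<Sum>b\<in>UNIV. torus_integral (\<lambda>y. d y * partial_deriv b (partial_deriv a (G a b)) y))"
    using d_smooth d_periodic G_smooth G_periodic by (simp add: torus_integral_by_parts2)
  also have "\<dots> = torus_integral (\<lambda>y. \<Sum>a\<in>UNIV. \<Sum>b\<in>UNIV. d y * partial_deriv b (partial_deriv a (G a b)) y)"
    by (simp add: torus_integral_sum smooth_sum smooth_mult d_smooth G_smooth smooth_partial)
  also have "\<dots> = 0"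
    unfolding sum_distrib_left[symmetric] G_div by (simp add: torus_integral_def)
  finally have "torus_integral (\<lambda>y. - E y) = 0"
    by (simp add: torus_integral_def)
  moreover have "continuous_on UNIV (\<lambda>y. - E y)" "periodic (\<lambda>y. - E y)"
    using smooth_continuous[OF smooth_minus[OF E_smooth]] E_periodic by (simp_all add: periodic_def)
  ultimately have "- E y = 0"
    using mono(1) by (intro torus_integral_zero_imp[of "\<lambda>y. - E y"]) simp_all
  then show ?thesis using mono(2)[of y] by simp
qed

text \<open>Equal Hessians leave the difference of the potentials with constant gradient. That
  difference is periodic, so the gradient is 0 and only an additive constant survives.\<close>

lemma solution_unique:
  assumes "solves_real_moment_map \<xi> u"
  shows "solves_real_moment_map \<xi> v \<longleftrightarrow> (\<exists>k. v = (\<lambda>y. u y + k))"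
proof
  assume v: "solves_real_moment_map \<xi> v"
  have su: "symplectic_potential u" and sv: "symplectic_potential v"
    using assms v unfolding solves_real_moment_map_def by simp_all
  obtain \<phi> where \<phi>: "smooth \<phi>" "periodic \<phi>" "u = (\<lambda>y. u0 y + \<phi> y)"
    using su unfolding symplectic_potential_def by (elim conjE exE)
  obtain \<psi> where \<psi>: "smooth \<psi>" "periodic \<psi>" "v = (\<lambda>y. u0 y + \<psi> y)"
    using sv unfolding symplectic_potential_def by (elim conjE exE)
  define d where "d = (\<lambda>y. \<psi> y - \<phi> y)"
  have d: "smooth d" "periodic d"
    using smooth_diff[OF \<psi>(1) \<phi>(1)] \<phi>(2) \<psi>(2) by (simp_all add: d_def periodic_def)
  have "partial_deriv b (partial_deriv a d) y = hessian v y $ a $ b - hessian u y $ a $ b" for a b y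
    unfolding d_def \<phi>(3) \<psi>(3) hessian_u0_add[OF \<phi>(1)] hessian_u0_add[OF \<psi>(1)]
    by (simp add: partial_deriv_smooth_diff smooth_partial \<phi> \<psi>)
  then have dd: "partial_deriv b (partial_deriv a d) y = 0" for a b y
    using solution_hessian_unique[OF v assms, of y] by simp
  have "partial_deriv a d y = 0" for a y
  proof (rule partial_deriv_zero_of_line_const[OF d(2) smooth_differentiable[OF d(1)]])
    obtain k where k: "\<forall>y. partial_deriv a d y = k"
      using const_of_partial_zero[OF smooth_differentiable[OF smooth_partial[OF d(1)]] dd, of a] by (elim exE)
    show "partial_deriv a d (y + s *\<^sub>R axis a 1) = partial_deriv a d y" for y s
      by (simp only: k)
  qed
  then have "\<exists>k. \<forall>y. d y = k"
    by (rule const_of_partial_zero[OF smooth_differentiable[OF d(1)]])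
  then obtain k where k: "\<forall>y. d y = k" by (elim exE)
  have "v y = u y + k" for y
    using k[rule_format, of y] by (simp add: d_def \<phi>(3) \<psi>(3))
  then show "\<exists>k. v = (\<lambda>y. u y + k)" by (intro exI ext)
next
  assume "\<exists>k. v = (\<lambda>y. u y + k)"
  then obtain k where k: "v = (\<lambda>y. u y + k)" by (elim exE)
  have su: "symplectic_potential u" using assms unfolding solves_real_moment_map_def by simp
  have hess: "hessian v = hessian u"
    unfolding k by (rule hessian_add_const[OF potential_smooth[OF su]])
  obtain \<phi> where \<phi>: "smooth \<phi>" "periodic \<phi>" "u = (\<lambda>y. u0 y + \<phi> y)"
    using su unfolding symplectic_potential_def by (elim conjE exE)
  have "smooth (\<lambda>y. \<phi> y + k)" "periodic (\<lambda>y. \<phi> y + k)" "v = (\<lambda>y. u0 y + (\<phi> y + k))"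
    using \<phi> by (simp_all add: k periodic_def add.assoc smooth_add smooth_const)
  then have "symplectic_potential v"
    using su unfolding symplectic_potential_def hess by (intro conjI exI) (assumption | simp)+
  moreover have "higgs_endo \<xi> v = higgs_endo \<xi> u"
    by (rule ext) (simp only: higgs_endo_def hess)
  ultimately show "solves_real_moment_map \<xi> v"
    using assms unfolding solves_real_moment_map_def admissible_def hess by simp
qed

text \<open>The equation and admissibility involve a potential only through its Hessian, so a
  potential with the translated Hessian is again a solution.\<close>

lemma solution_translate:
  assumes "solves_real_moment_map \<xi> u" and inv: "\<And>y. \<xi> (y + z) = \<xi> y"
  shows "hessian u (y + z) = hessian u y"
proof -
  have u: "symplectic_potential u" "admissible \<xi> u" "\<And>y. div2 (moment_matrix u) y = 0"
    using assms unfolding solves_real_moment_map_def by simp_all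
  obtain v where v: "symplectic_potential v" "\<And>y. hessian v y = hessian u (y + z)"
    by (rule potential_translate[OF u(1), where z = z]) (rule that)
  have endo: "higgs_endo \<xi> v y = higgs_endo \<xi> u (y + z)" for y
    by (simp only: higgs_endo_def v(2) inv)
  have "partial_deriv b (partial_deriv a (\<lambda>y. moment_matrix u (y + z) $ a $ b)) y =
      partial_deriv b (partial_deriv a (\<lambda>y. moment_matrix u y $ a $ b)) (y + z)" for a b y
    unfolding partial_deriv_translate[of a "\<lambda>y. moment_matrix u y $ a $ b" z]
      partial_deriv_translate[of b "partial_deriv a (\<lambda>y. moment_matrix u y $ a $ b)" z] ..
  then have "div2 (moment_matrix v) y = div2 (moment_matrix u) (y + z)" for y
    unfolding endo v(2) div2_def by simp
  then have "solves_real_moment_map \<xi> v"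
    using v(1) u unfolding solves_real_moment_map_def admissible_def endo by simp
  from solution_hessian_unique[OF this assms(1), of y] show ?thesis by (simp only: v(2))
qed

end

section \<open>The scalar equation\<close>

lemma frac_strict_mono_cross:
  fixes a c d e :: real
  assumes "0 < c" "0 < e" "a * e < d * c"
  shows "a / c < d / e"
proof -
  have "a < (d * c) / e" using assms(2,3) by (simp only: pos_less_divide_eq)
  also have "\<dots> = (d / e) * c" by simp
  finally show ?thesis using assms(1) by (simp only: pos_divide_less_eq)
qed

text \<open>For \<open>D\<^sup>2u = diag (\<eta>, 1)\<close> with \<open>\<eta>\<close> depending on \<open>y\<^sup>1\<close> only, the real moment map equation in
  case (ii) says that \<open>1 / \<eta> - b\<close> is a constant \<open>K\<close>, where \<open>b = bfun r\<^sup>2 (\<eta> + x)\<close>, \<open>r = |c|\<close> and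
  \<open>x = |\<xi>\<^sup>1\<^sup>2 / c|\<^sup>2\<close>. Solving the definition of \<open>b\<close> for its argument removes the square root,
  \<open>\<eta> + x = 2 b / (r\<^sup>2 + b\<^sup>2)\<close>, and with \<open>\<eta> = 1 / (K + b)\<close> the equation becomes \<open>psi r K b = x\<close>.
  For \<open>r < 3 / 10\<close> it has a root in \<open>(0, r)\<close> for all \<open>K\<close> between \<open>9 / 10\<close> and \<open>1\<close>, and at these two
  ends \<open>\<eta> \<ge> 1\<close> and \<open>\<eta> \<le> 1\<close>, so that \<open>\<eta>\<close> has mean \<open>1\<close> for some \<open>K\<close> in between.\<close>

definition psi :: "real \<Rightarrow> real \<Rightarrow> real \<Rightarrow> real"
  where "psi r K b = 2 * b / (r * r + b * b) - 1 / (K + b)"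

text \<open>Written with products and \<open>inverse\<close>, the shape to which the finite-order
  closure lemmas apply in \<open>psi_root_smooth\<close>.\<close>

definition psi_deriv :: "real \<Rightarrow> real \<Rightarrow> real \<Rightarrow> real"
  where "psi_deriv r K b = 2 * (r * r - b * b) * inverse ((r * r + b * b) * (r * r + b * b))
    + inverse ((K + b) * (K + b))"

definition psi_root :: "real \<Rightarrow> real \<Rightarrow> real \<Rightarrow> real"
  where "psi_root r K x = (SOME b. 0 < b \<and> b < r \<and> psi r K b = x)"

definition eta_root :: "real \<Rightarrow> real \<Rightarrow> real \<Rightarrow> real"
  where "eta_root r K x = 1 / (K + psi_root r K x)"

context
  fixes r :: real
  assumes r: "0 < r" "r < 3 / 10"
begin

text \<open>After cross-multiplication the difference factors as 2 (b' - b) (r^2 - b b').\<close>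

lemma rational_part_mono:
  assumes "0 \<le> b" "b < b'" "b' \<le> r"
  shows "2 * b / (r * r + b * b) < 2 * b' / (r * r + b' * b')"
proof (rule frac_strict_mono_cross)
  have rr: "0 < r * r" using r by simp
  show "0 < r * r + b * b" "0 < r * r + b' * b'"
    using rr by (intro add_pos_nonneg zero_le_square; assumption)+
  have "b * b' \<le> b * r" using assms by (intro mult_left_mono) simp_all
  also have "\<dots> < r * r" using assms r by (intro mult_strict_right_mono) simp_all
  finally have "0 < 2 * (b' - b) * (r * r - b * b')" using assms by (intro mult_pos_pos) simp_all
  also have "\<dots> = 2 * b' * (r * r + b * b) - 2 * b * (r * r + b' * b')"
    by (simp add: algebra_simps)
  finally show "2 * b * (r * r + b' * b') < 2 * b' * (r * r + b * b)" by linarith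
qed

lemma psi_strict_mono:
  assumes "9 / 10 \<le> K" "0 \<le> b" "b < b'" "b' \<le> r"
  shows "psi r K b < psi r K b'"
proof -
  have "1 / (K + b') \<le> 1 / (K + b)" using assms by (intro divide_left_mono mult_pos_pos) simp_all
  then show ?thesis using rational_part_mono[OF assms(2-4)] unfolding psi_def by linarith
qed

lemma psi_has_derivative:
  assumes "9 / 10 \<le> K" "0 \<le> b"
  shows "(psi r K has_real_derivative psi_deriv r K b) (at b)"
proof -
  have nz: "r * r + b * b \<noteq> 0" "K + b \<noteq> 0"
    using assms r by (simp_all add: add_pos_nonneg less_imp_neq[THEN not_sym])
  have "((\<lambda>b. 2 * b / (r * r + b * b) - 1 / (K + b)) has_real_derivative
      (2 * (r * r + b * b) - 2 * b * (2 * b)) / ((r * r + b * b) * (r * r + b * b))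
      - (- 1 / ((K + b) * (K + b)))) (at b)"
    using nz by (auto intro!: derivative_eq_intros simp del: mult_eq_0_iff)
  moreover have "(2 * (r * r + b * b) - 2 * b * (2 * b)) / ((r * r + b * b) * (r * r + b * b))
      - (- 1 / ((K + b) * (K + b))) = psi_deriv r K b"
    unfolding psi_deriv_def divide_inverse by (simp add: algebra_simps)
  ultimately show ?thesis by (simp add: psi_def[abs_def])
qed

lemma psi_deriv_pos:
  assumes "9 / 10 \<le> K" "0 \<le> b" "b < r"
  shows "0 < psi_deriv r K b"
proof -
  have "b * b \<le> r * r" using assms by (intro mult_mono) simp_all
  then have "0 \<le> 2 * (r * r - b * b) * inverse ((r * r + b * b) * (r * r + b * b))" by simp
  moreover have "0 < inverse ((K + b) * (K + b))" using assms by simp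
  ultimately show ?thesis unfolding psi_deriv_def by linarith
qed

text \<open>At 0 the value is -1/K \<le> -1, and at r it is 1/r - 1/(K + r) \<ge> 10/3 - 10/9 > 2.
  The open range from -1 to 2 surrounds the interval [0, 1] in which x lies later, so the root can
  be differentiated at its ends too.\<close>

lemma psi_root_exists:
  assumes "9 / 10 \<le> K" "K \<le> 1" "-1 < x" "x < 2"
  shows "\<exists>b. 0 < b \<and> b < r \<and> psi r K b = x"
proof -
  have "1 \<le> 1 / K" using assms by simp
  moreover have "psi r K 0 = - (1 / K)" by (simp add: psi_def)
  ultimately have 0: "psi r K 0 < x" using assms(3) by linarith
  have "2 * r / (r * r + r * r) = 1 / r" using r by simp
  moreover have "10 / 3 \<le> 1 / r" using r by (simp add: pos_le_divide_eq)
  moreover have "1 / (K + r) \<le> 10 / 9" using r assms by (simp add: pos_divide_le_eq)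
  ultimately have 1: "x < psi r K r" using assms unfolding psi_def by linarith
  have "isCont (psi r K) b" if "0 \<le> b" for b
    using psi_has_derivative[OF assms(1) that] by (rule DERIV_isCont)
  then obtain b where b: "0 \<le> b" "b \<le> r" "psi r K b = x"
    using IVT[of "psi r K" 0 x r] 0 1 r by (auto simp: less_imp_le)
  moreover have "b \<noteq> 0" "b \<noteq> r" using b(3) 0 1 by auto
  ultimately show ?thesis by (intro exI[of _ b]) simp
qed

lemma psi_root:
  assumes "9 / 10 \<le> K" "K \<le> 1" "-1 < x" "x < 2"
  shows "0 < psi_root r K x" "psi_root r K x < r" "psi r K (psi_root r K x) = x"
  using someI_ex[OF psi_root_exists[OF assms]] unfolding psi_root_def by simp_all

text \<open>Supplies the continuity that the inverse function rule demands. The rational part of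
  \<open>psi\<close> only helps, and the increment of -1/(K + b) is at least a quarter of that of b
  because K + b \<le> 2.\<close>

lemma psi_root_lipschitz:
  assumes K: "9 / 10 \<le> K" "K \<le> 1" and x: "-1 < x" "x < 2" and y: "-1 < y" "y < 2"
  shows "\<bar>psi_root r K x - psi_root r K y\<bar> \<le> 4 * \<bar>x - y\<bar>"
proof -
  have *: "\<bar>psi_root r K x - psi_root r K y\<bar> \<le> 4 * \<bar>x - y\<bar>"
    if less: "psi_root r K y < psi_root r K x" and x: "-1 < x" "x < 2" and y: "-1 < y" "y < 2" for x y
  proof -
    define b b' where "b = psi_root r K x" and "b' = psi_root r K y"
    have b: "0 < b" "b < r" "psi r K b = x" and b': "0 < b'" "b' < r" "psi r K b' = y"
      using psi_root[OF K x] psi_root[OF K y] by (simp_all add: b_def b'_def)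
    have bb: "b' < b" using less by (simp add: b_def b'_def)
    have "2 * b' / (r * r + b' * b') < 2 * b / (r * r + b * b)"
      using b b' bb by (intro rational_part_mono) simp_all
    then have 1: "1 / (K + b') - 1 / (K + b) \<le> x - y" using b(3) b'(3) unfolding psi_def by linarith
    have pos: "0 < K + b'" "0 < K + b" using K b b' by simp_all
    have "(K + b') * (K + b) \<le> 2 * 2" using K b b' r by (intro mult_mono) simp_all
    then have "(b - b') / 4 \<le> (b - b') / ((K + b') * (K + b))"
      using bb pos by (intro divide_left_mono) simp_all
    also have "\<dots> = 1 / (K + b') - 1 / (K + b)" using pos by (simp add: diff_frac_eq)
    finally have "(b - b') / 4 \<le> x - y" using 1 by (rule order_trans)
    then have "b - b' \<le> 4 * (x - y)" by simp
    also have "\<dots> \<le> 4 * \<bar>x - y\<bar>" by (intro mult_left_mono abs_ge_self) simp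
    finally show ?thesis using bb unfolding b_def b'_def by simp
  qed
  consider "psi_root r K y < psi_root r K x" | "psi_root r K x < psi_root r K y" | "psi_root r K x = psi_root r K y"
    by linarith
  then show ?thesis
  proof cases
    case 1 then show ?thesis using *[OF _ x y] by simp
  next
    case 2 then show ?thesis using *[OF _ y x] by (simp add: abs_minus_commute)
  qed simp
qed

lemma psi_root_has_derivative:
  assumes K: "9 / 10 \<le> K" "K \<le> 1" and x: "-1 < x" "x < 2"
  shows "(psi_root r K has_real_derivative inverse (psi_deriv r K (psi_root r K x))) (at x)"
proof (rule DERIV_inverse_function[where f = "psi r K" and a = "-1" and b = 2])
  note p = psi_root[OF K x]
  show "(psi r K has_real_derivative psi_deriv r K (psi_root r K x)) (at (psi_root r K x))"
    using p by (intro psi_has_derivative K) simp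
  show "psi_deriv r K (psi_root r K x) \<noteq> 0"
    using psi_deriv_pos[OF K(1) less_imp_le[OF p(1)] p(2)] by simp
  show "psi r K (psi_root r K y) = y" if "-1 < y" "y < 2" for y
    using psi_root(3)[OF K that] .
  have "((\<lambda>y. \<bar>psi_root r K y - psi_root r K x\<bar>) \<longlongrightarrow> 0) (at x)"
  proof (rule tendsto_sandwich[OF _ _ tendsto_const])
    have "\<forall>\<^sub>F y in at x. y \<in> {-1<..<2}"
      using x by (intro eventually_at_in_open') simp_all
    then show "\<forall>\<^sub>F y in at x. \<bar>psi_root r K y - psi_root r K x\<bar> \<le> 4 * \<bar>y - x\<bar>"
      by eventually_elim (use psi_root_lipschitz[OF K _ _ x] in simp)
    show "((\<lambda>y. 4 * \<bar>y - x\<bar>) \<longlongrightarrow> 0) (at x)"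
      by (auto intro!: tendsto_eq_intros)
  qed simp
  then show "isCont (psi_root r K) x"
    unfolding isCont_def tendsto_rabs_zero_iff by (rule LIM_zero_cancel)
qed (use x in simp_all)

text \<open>Makes the mean of \<open>eta_root\<close> continuous in K. For b' \<le> b the equation
  at the common x forces K + b \<le> K' + b', so the denominators differ by at most K' - K, and
  their product is at least 81/100 \<ge> 1/2.\<close>

lemma eta_root_lipschitz:
  assumes K: "9 / 10 \<le> K" "K \<le> 1" and K': "9 / 10 \<le> K'" "K' \<le> 1" and x: "-1 < x" "x < 2"
  shows "\<bar>eta_root r K x - eta_root r K' x\<bar> \<le> 2 * \<bar>K - K'\<bar>"
proof -
  have *: "\<bar>eta_root r K x - eta_root r K' x\<bar> \<le> 2 * \<bar>K - K'\<bar>"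
    if le: "psi_root r K' x \<le> psi_root r K x" and K: "9 / 10 \<le> K" "K \<le> 1" and K': "9 / 10 \<le> K'" "K' \<le> 1"
    for K K'
  proof -
    define b b' where "b = psi_root r K x" and "b' = psi_root r K' x"
    have b: "0 < b" "b < r" "psi r K b = x" and b': "0 < b'" "b' < r" "psi r K' b' = x"
      using psi_root[OF K x] psi_root[OF K' x] by (simp_all add: b_def b'_def)
    have bb: "b' \<le> b" using le by (simp add: b_def b'_def)
    have "2 * b' / (r * r + b' * b') \<le> 2 * b / (r * r + b * b)"
      using b b' bb rational_part_mono[of b' b] by (cases "b' = b") (simp_all add: less_imp_le)
    then have 1: "1 / (K' + b') \<le> 1 / (K + b)" using b(3) b'(3) unfolding psi_def by linarith
    have pos: "9 / 10 \<le> K' + b'" "9 / 10 \<le> K + b" using K K' b b' by simp_all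
    have 2: "K + b \<le> K' + b'" 
    proof (rule ccontr)
      assume "\<not> K + b \<le> K' + b'"
      then have "1 / (K + b) < 1 / (K' + b')" using pos by (intro divide_strict_left_mono mult_pos_pos) simp_all
      then show False using 1 by simp
    qed
    have "(9 / 10) * (9 / 10) \<le> (K + b) * (K' + b')" using pos by (intro mult_mono) simp_all
    then have m: "1 / 2 \<le> (K + b) * (K' + b')" by simp
    have "1 / (K + b) - 1 / (K' + b') = ((K' + b') - (K + b)) / ((K + b) * (K' + b'))"
      using pos by (simp add: diff_frac_eq)
    also have "\<dots> \<le> ((K' + b') - (K + b)) / (1 / 2)"
      using 2 m by (intro divide_left_mono) simp_all
    also have "\<dots> \<le> 2 * \<bar>K - K'\<bar>" using bb abs_ge_minus_self[of "K - K'"] by simp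
    finally show ?thesis using 1 unfolding eta_root_def b_def b'_def by simp
  qed
  show ?thesis
  proof (cases "psi_root r K' x \<le> psi_root r K x")
    case True then show ?thesis using *[OF _ K K'] by simp
  next
    case False then show ?thesis using *[OF _ K' K] by (simp add: abs_minus_commute)
  qed
qed

text \<open>The claim is b \<le> 1/10. As r < 3/10 gives r^2 + 1/100 \<le> 1/10, the value of
  \<open>psi\<close> at 1/10 is at least 2 - 1 = 1 \<ge> x, and \<open>psi\<close> is strictly
  increasing.\<close>

lemma eta_root_ge_1:
  assumes "-1 < x" "x \<le> 1"
  shows "1 \<le> eta_root r (9 / 10) x"
proof -
  define b where "b = psi_root r (9 / 10) x"
  have b: "0 < b" "b < r" "psi r (9 / 10) b = x"
    using psi_root[of "9/10" x] assms by (simp_all add: b_def)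
  have "b \<le> 1 / 10"
  proof (rule ccontr)
    assume "\<not> b \<le> 1 / 10"
    then have "psi r (9 / 10) (1 / 10) < x" using psi_strict_mono[of "9/10" "1/10" b] b by simp
    moreover have "r * r \<le> (3 / 10) * (3 / 10)" using r by (intro mult_mono) simp_all
    then have "2 \<le> (2 / 10) / (r * r + 1 / 100)" using r by (simp add: pos_le_divide_eq add_pos_pos)
    then have "1 \<le> psi r (9 / 10) (1 / 10)" unfolding psi_def by simp
    ultimately show False using assms by simp
  qed
  then show ?thesis using b(1) unfolding eta_root_def b_def[symmetric] by (simp add: pos_le_divide_eq)
qed

lemma eta_root_le_1:
  assumes "-1 < x" "x < 2"
  shows "eta_root r 1 x \<le> 1"
  using psi_root(1)[of 1 x] assms unfolding eta_root_def by (simp add: pos_divide_le_eq)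

lemma eta_root_continuous:
  assumes K: "9 / 10 \<le> K" "K \<le> 1" and m: "continuous_on {0..1} m" "\<And>t. 0 \<le> m t" "\<And>t. m t \<le> 1"
  shows "continuous_on {0..1::real} (\<lambda>t. eta_root r K (m t))"
proof -
  have m': "-1 < m t" "m t < 2" for t using m(2,3)[of t] by simp_all
  have "continuous_on {-1<..<2} (psi_root r K)"
    by (intro continuous_at_imp_continuous_on ballI DERIV_isCont[OF psi_root_has_derivative[OF K]]) simp_all
  then have "continuous_on {0..1} (\<lambda>t. psi_root r K (m t))"
    by (rule continuous_on_compose2[OF _ m(1)]) (use m' in auto)
  moreover have "K + psi_root r K (m t) \<noteq> 0" for t
    using psi_root(1)[OF K m'] K by (simp add: less_imp_neq add_pos_pos not_sym)
  ultimately show ?thesis unfolding eta_root_def by (intro continuous_intros ballI)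
qed

text \<open>Mean 1 is the condition for \<open>\<eta>\<close> - 1 to be a second derivative of a
  periodic function. The means at K = 9/10 and K = 1 lie on opposite sides of 1.\<close>

lemma eta_root_mean_1:
  assumes m: "continuous_on {0..1} m" "\<And>t. 0 \<le> m t" "\<And>t. m t \<le> 1"
  obtains K where "9 / 10 \<le> K" "K \<le> 1" "integral {0..1::real} (\<lambda>t. eta_root r K (m t)) = 1"
proof -
  define J where "J K = integral {0..1::real} (\<lambda>t. eta_root r K (m t))" for K
  have m': "-1 < m t" "m t < 2" for t using m(2,3)[of t] by simp_all
  have int: "(\<lambda>t. eta_root r K (m t)) integrable_on {0..1}" if "9 / 10 \<le> K" "K \<le> 1" for K
    by (rule integrable_continuous_interval[OF eta_root_continuous[OF that m]])
  have lip: "\<bar>J K - J L\<bar> \<le> 2 * \<bar>K - L\<bar>" if K: "9 / 10 \<le> K" "K \<le> 1" and L: "9 / 10 \<le> L" "L \<le> 1" for K L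
  proof -
    have "norm (integral {0..1::real} (\<lambda>t. eta_root r K (m t) - eta_root r L (m t))) \<le>
        integral {0..1::real} (\<lambda>t. 2 * \<bar>K - L\<bar>)"
      using eta_root_lipschitz[OF K L m']
      by (intro integral_norm_bound_integral integrable_diff int K L integrable_const_ivl) simp
    then show ?thesis unfolding J_def by (simp add: integral_diff[OF int[OF K] int[OF L]])
  qed
  have "continuous_on {9/10..1} J"
    unfolding continuous_on_iff
  proof (intro ballI allI impI)
    fix K e :: real assume K: "K \<in> {9/10..1}" and e: "0 < e"
    have "dist (J L) (J K) < e" if "L \<in> {9/10..1}" "dist L K < e / 2" for L
      using lip[of L K] K that by (simp add: dist_real_def)
    then show "\<exists>d>0. \<forall>L\<in>{9/10..1}. dist L K < d \<longrightarrow> dist (J L) (J K) < e"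
      using e by (intro exI[of _ "e / 2"]) simp
  qed
  moreover have "J 1 \<le> 1"
  proof -
    have "J 1 \<le> integral {0..1::real} (\<lambda>t. 1)"
      unfolding J_def by (intro integral_le int integrable_const_ivl eta_root_le_1 m') simp_all
    then show ?thesis by simp
  qed
  moreover have "1 \<le> J (9 / 10)"
  proof -
    have "integral {0..1::real} (\<lambda>t. 1) \<le> J (9 / 10)"
      unfolding J_def by (intro integral_le int integrable_const_ivl eta_root_ge_1 m' m) simp_all
    then show ?thesis by simp
  qed
  ultimately have "\<exists>K. 9 / 10 \<le> K \<and> K \<le> 1 \<and> J K = 1"
    by (intro IVT2') simp_all
  then show ?thesis using that unfolding J_def by (elim exE conjE)
qed

text \<open>The derivative of the root is a rational expression in the root itself, times a
  derivative of \<open>m\<close>, which is the situation of \<open>smooth_bootstrap\<close>.\<close>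

lemma psi_root_smooth:
  fixes m :: "real^'n \<Rightarrow> real"
  assumes K: "9 / 10 \<le> K" "K \<le> 1" and m: "smooth m" "\<And>y. 0 \<le> m y" "\<And>y. m y \<le> 1"
  shows "smooth (\<lambda>y. psi_root r K (m y))"
proof (rule smooth_bootstrap)
  have m': "-1 < m y" "m y < 2" for y using m(2,3)[of y] by simp_all
  note p = psi_root[OF K m']
  show "(\<lambda>y. psi_root r K (m y)) differentiable at y" for y
    by (rule differentiable_real_compose[OF smooth_differentiable[OF m(1)] psi_root_has_derivative[OF K m']])
  have pd: "partial_deriv a (\<lambda>y. psi_root r K (m y)) =
      (\<lambda>y. partial_deriv a m y * inverse (psi_deriv r K (psi_root r K (m y))))" for a
    by (intro ext partial_deriv_real_compose[OF smooth_differentiable[OF m(1)] psi_root_has_derivative[OF K m']])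
  have nz: "(r * r + psi_root r K (m y) * psi_root r K (m y)) *
      (r * r + psi_root r K (m y) * psi_root r K (m y)) \<noteq> 0"
    "(K + psi_root r K (m y)) * (K + psi_root r K (m y)) \<noteq> 0" "psi_deriv r K (psi_root r K (m y)) \<noteq> 0" for y
  proof -
    have "0 < r * r" using r by simp
    then have "0 < r * r + psi_root r K (m y) * psi_root r K (m y)" by (rule add_pos_nonneg) simp
    then have "0 < (r * r + psi_root r K (m y) * psi_root r K (m y)) *
      (r * r + psi_root r K (m y) * psi_root r K (m y))" by (intro mult_pos_pos)
    then show "(r * r + psi_root r K (m y) * psi_root r K (m y)) *
      (r * r + psi_root r K (m y) * psi_root r K (m y)) \<noteq> 0" by (rule less_imp_neq[THEN not_sym])
    show "(K + psi_root r K (m y)) * (K + psi_root r K (m y)) \<noteq> 0" using p(1)[of y] K by simp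
    show "psi_deriv r K (psi_root r K (m y)) \<noteq> 0"
      using psi_deriv_pos[OF K(1) less_imp_le[OF p(1)] p(2), of y] by simp
  qed
  fix n a assume s: "smooth_upto n (\<lambda>y. psi_root r K (m y))"
  have neg: "smooth_upto n (\<lambda>y. r * r - psi_root r K (m y) * psi_root r K (m y))"
    using smooth_upto_add[OF smooth_upto_const smooth_upto_mult[OF smooth_upto_const[of n "-1"] smooth_upto_mult[OF s s]], of "r * r"]
    by simp
  show "smooth_upto n (partial_deriv a (\<lambda>y. psi_root r K (m y)))"
    unfolding pd
  proof (intro smooth_upto_mult smooth_upto_inverse nz)
    show "smooth_upto n (partial_deriv a m)" using smooth_partial[OF m(1)] by (simp add: smooth_iff_upto)
    show "smooth_upto n (\<lambda>y. psi_deriv r K (psi_root r K (m y)))"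
      unfolding psi_deriv_def
      by (intro smooth_upto_mult smooth_upto_inverse smooth_upto_add smooth_upto_const s neg nz)
  qed
qed

end

section \<open>Potentials depending on the first coordinate\<close>

text \<open>Stated as translation invariance rather than as a factorisation through the first
  coordinate, so that it passes to partial derivatives by
  \<open>partial_deriv_translate\<close>.\<close>

definition indep2 :: "(real^2 \<Rightarrow> 'b) \<Rightarrow> bool"
  where "indep2 f \<longleftrightarrow> (\<forall>y s. f (y + s *\<^sub>R axis 2 1) = f y)"

lemma indep2D: "indep2 f \<Longrightarrow> f (y + s *\<^sub>R axis 2 1) = f y"
  by (simp add: indep2_def)

lemma indep2_first_coordinate: "indep2 (\<lambda>y. F (y $ 1))"
  by (simp add: indep2_def axis_def)

lemma indep2_partial:
  assumes "indep2 f"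
  shows "indep2 (partial_deriv a f)"
proof -
  have eq: "(\<lambda>y. f (y + s *\<^sub>R axis 2 1)) = f" for s
    by (rule ext) (rule indep2D[OF assms])
  show ?thesis
    unfolding indep2_def
  proof (intro allI)
    fix y s show "partial_deriv a f (y + s *\<^sub>R axis 2 1) = partial_deriv a f y"
      using fun_cong[OF partial_deriv_translate[of a f "s *\<^sub>R axis 2 1"], of y] unfolding eq by simp
  qed
qed

lemma partial_2_indep2: "indep2 f \<Longrightarrow> partial_deriv 2 f = (\<lambda>y. 0)"
  by (rule ext) (simp add: partial_deriv_def indep2D)

lemma indep2_pt:
  assumes "indep2 f"
  shows "f (pt (y $ 1) 0) = f y"
  using indep2D[OF assms, of "pt (y $ 1) 0" "y $ 2"] by (simp add: pt_line pt_eta)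

lemma const_of_indep2_partial_zero:
  fixes f :: "real^2 \<Rightarrow> 'b::real_normed_vector"
  assumes "smooth f" "indep2 f" "\<And>y. partial_deriv 1 f y = 0"
  shows "\<exists>k. \<forall>y. f y = k"
proof (rule const_of_partial_zero)
  fix a y show "partial_deriv a f y = 0"
    using exhaust_2[of a] assms(3) partial_2_indep2[OF assms(2)] by auto
qed (rule smooth_differentiable[OF assms(1)])

lemma div2_indep2:
  assumes "\<And>a b. indep2 (\<lambda>y. A y $ a $ b)"
  shows "div2 A y = partial_deriv 1 (partial_deriv 1 (\<lambda>y. A y $ 1 $ 1)) y"
  by (simp add: div2_def sum_2 partial_2_indep2[OF assms] partial_2_indep2[OF indep2_partial[OF assms]])

context rank_one_higgs
begin

text \<open>Only the (1,1) entry survives in the double divergence, and its imaginary part vanishes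
  because w1 times its conjugate is real. A constant flux is therefore enough.\<close>

lemma solves_of_indep2:
  assumes u: "symplectic_potential u"
    and adm: "\<And>y. (cmod (\<kappa> y))\<^sup>2 * (hval (hessian u y) (w y))\<^sup>2 < 1"
    and indep: "indep2 \<kappa>" "indep2 w" "indep2 (hessian u)"
    and flux: "\<And>y. flux (\<kappa> y) (w y) (hessian u y) 1 1 = K"
  shows "solves_real_moment_map \<xi> u"
proof -
  have "moment_matrix u y $ 1 $ 1 = of_real K" for y
  proof (rule complex_eqI)
    show "Re (moment_matrix u y $ 1 $ 1) = Re (of_real K)"
      by (simp only: Re_moment_matrix[OF u adm] flux Re_complex_of_real)
    show "Im (moment_matrix u y $ 1 $ 1) = Im (of_real K)"
      by (simp add: moment_matrix_nth[OF u adm])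
  qed
  moreover have "indep2 (\<lambda>y. moment_matrix u y $ a $ b)" for a b
    using indep unfolding higgs_endo_eq indep2_def by simp
  ultimately have "div2 (moment_matrix u) y = 0" for y
    by (simp add: div2_indep2)
  then show ?thesis
    unfolding solves_real_moment_map_def admissible_iff[OF u] using u adm by simp
qed

text \<open>Translating in y^2 preserves \<xi> and hence the Hessian, so the y^2-derivative of each
  first derivative of \<open>\<phi>\<close> is constant along y^2-lines and, by periodicity,
  zero.\<close>

lemma solution_diagonal:
  assumes "solves_real_moment_map \<xi> u" "indep2 \<xi>"
  shows "hessian u y $ 1 $ 2 = 0" "hessian u y $ 2 $ 1 = 0" "hessian u y $ 2 $ 2 = 1"
proof -
  have u: "symplectic_potential u"
    using assms(1) unfolding solves_real_moment_map_def by simp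
  obtain \<phi> where \<phi>: "smooth \<phi>" "periodic \<phi>"
    "\<And>y a b. hessian u y $ a $ b = (if b = a then 1 else 0) + partial_deriv b (partial_deriv a \<phi>) y"
    using u by (rule potential_obtain) blast
  have inv: "hessian u (y + s *\<^sub>R axis 2 1) = hessian u y" for y s
    by (rule solution_translate[OF assms(1)]) (rule indep2D[OF assms(2)])
  have zero: "partial_deriv 2 (partial_deriv a \<phi>) y = 0" for a
  proof (rule partial_deriv_zero_of_line_const)
    show "periodic (partial_deriv a \<phi>)" by (rule periodic_partial[OF \<phi>(2)])
    show "partial_deriv a \<phi> differentiable at y" for y
      by (rule smooth_differentiable[OF smooth_partial[OF \<phi>(1)]])
    show "partial_deriv 2 (partial_deriv a \<phi>) (y + s *\<^sub>R axis 2 1) = partial_deriv 2 (partial_deriv a \<phi>) y" for y s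
      using arg_cong[OF inv[of y s], of "\<lambda>H. H $ a $ 2"] by (simp add: \<phi>(3))
  qed
  show "hessian u y $ 1 $ 2 = 0" "hessian u y $ 2 $ 2 = 1"
    by (simp_all add: \<phi>(3) zero)
  then show "hessian u y $ 2 $ 1 = 0"
    using pos_def_2D(1)[OF potential_pos_def[OF u], of y] by simp
qed

text \<open>Only the component \<open>a = 1\<close>, \<open>c = b = 2\<close> of the integrability condition is needed: the Hessian is
  \<open>diag (\<eta>, 1)\<close>, so it reads \<open>\<partial>\<^sub>1 \<xi>\<^sup>2\<^sup>2 = 0\<close>.\<close>
lemma integrable_imp:
  assumes sol: "solves_real_moment_map \<xi> u" and indep: "indep2 \<xi>" and int: "integrable_deformation \<xi> u"
  shows "partial_deriv 1 (\<lambda>y. \<xi> y $ 2 $ 2) y = 0"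
proof -
  note diag = solution_diagonal[OF sol indep]
  have u: "symplectic_potential u"
    using sol unfolding solves_real_moment_map_def by simp
  note pd = potential_pos_def[OF u, of y]
  have d22: "deformation \<xi> u 2 2 = (\<lambda>y. \<xi> y $ 2 $ 2)" and d12: "deformation \<xi> u 1 2 = (\<lambda>y. \<xi> y $ 2 $ 1)"
    by (simp_all only: fun_eq_iff deformation_def sum_2 map_matrix_def vec_lambda_beta diag
        of_real_0 of_real_1 mult_zero_left mult_1_left add_0_left simp_thms)
  have "z_deriv u 1 (deformation \<xi> u 2 2) y = z_deriv u 2 (deformation \<xi> u 1 2) y"
    using int[unfolded integrable_deformation_def, rule_format, of 1 2 2 y] .
  moreover
  have i: "inv2 (hessian u y) 1 2 = 0" "inv2 (hessian u y) 2 1 = 0" "inv2 (hessian u y) 1 1 \<noteq> 0"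
    using pos_def_2D(2)[OF pd] by (simp_all only: inv2_simps diag minus_zero div_0 mult_1_right mult_zero_right diff_zero) simp
  have "indep2 (\<lambda>y. \<xi> y $ 2 $ 1)" using indep unfolding indep2_def by simp
  then have p: "partial_deriv 2 (\<lambda>y. \<xi> y $ 2 $ 1) y = 0" by (simp only: partial_2_indep2)
  note inv = matrix_inv_pos_def_2(1)[OF pd]
  have "z_deriv u 1 (\<lambda>y. \<xi> y $ 2 $ 2) y =
      of_real (inv2 (hessian u y) 1 1) * partial_deriv 1 (\<lambda>y. \<xi> y $ 2 $ 2) y / 2"
    by (simp only: z_deriv_def sum_2 inv vec_lambda_beta i of_real_0 mult_zero_left add_0_right)
  moreover have "z_deriv u 2 (\<lambda>y. \<xi> y $ 2 $ 1) y = 0"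
    by (simp only: z_deriv_def sum_2 inv vec_lambda_beta i p of_real_0 mult_zero_left mult_zero_right add_0_right div_0)
  ultimately show ?thesis using i(3) unfolding d22 d12 by simp
qed

lemma integrable_of_constant:
  assumes sol: "solves_real_moment_map \<xi> u" and const: "\<xi> constant_on UNIV"
  shows "integrable_deformation \<xi> u"
proof -
  obtain X where X: "\<xi> = (\<lambda>y. X)" using const unfolding constant_on_def by auto
  \<comment> \<open>A constant \<xi> is preserved by every translation, hence so is the
    Hessian.\<close>
  have H: "hessian u y = hessian u 0" for y
    using solution_translate[OF sol, where z = y and y = 0] by (simp add: X)
  have const: "(\<lambda>y. deformation \<xi> u c b 0) = deformation \<xi> u c b" for c b
    unfolding deformation_def X by (rule ext) (subst H, rule refl)
  have "partial_deriv e (deformation \<xi> u c b) y = 0" for e c b y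
    using fun_cong[OF partial_deriv_const[of e "deformation \<xi> u c b 0"], of y] unfolding const .
  then show ?thesis unfolding integrable_deformation_def z_deriv_def by simp
qed

text \<open>The two cases differ only in how constancy of \<xi>^22 yields that of \<xi>; the last
  hypothesis isolates this.\<close>

lemma integrable_iff_constant:
  assumes "solves_real_moment_map \<xi> u" "indep2 \<xi>"
    and "(\<And>y. partial_deriv 1 (\<lambda>y. \<xi> y $ 2 $ 2) y = 0) \<Longrightarrow> \<xi> constant_on UNIV"
  shows "integrable_deformation \<xi> u \<longleftrightarrow> \<xi> constant_on UNIV"
proof
  assume "integrable_deformation \<xi> u"
  from integrable_imp[OF assms(1,2) this] show "\<xi> constant_on UNIV" by (rule assms(3))
qed (rule integrable_of_constant[OF assms(1)])

end

section \<open>Potentials with prescribed diagonal Hessian and existence in case (ii)\<close>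

lemma periodic_antiderivative:
  fixes g :: "real \<Rightarrow> real"
  assumes cont: "continuous_on UNIV g" and per: "\<And>t. g (t + 1) = g t"
    and mean: "integral {0..1} g = 0"
  obtains G where "\<And>t. (G has_real_derivative g t) (at t)" "\<And>t. G (t + 1) = G t"
proof -
  have "isCont g t" for t using cont by (simp add: continuous_on_eq_continuous_at)
  then obtain G where "\<And>t. (G has_vector_derivative g t) (at t)"
    using einterval_antiderivative[of "-\<infinity>" "\<infinity>" g] by auto
  then have G: "(G has_real_derivative g t) (at t)" for t
    by (simp add: has_real_derivative_iff_has_vector_derivative)
  have "(g has_integral G 1 - G 0) {0..1}"
    proof (rule fundamental_theorem_of_calculus)
    show "(G has_vector_derivative g t) (at t within {0..1})" for t
      by (rule has_vector_derivative_at_within)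
        (rule G[unfolded has_real_derivative_iff_has_vector_derivative])
  qed simp
  then have 0: "G 1 - G 0 = 0" using mean by (simp add: integral_unique)
  \<comment> \<open>The increment of \<open>G\<close> over a period is independent of the starting
    point, and from 0 to 1 it is the vanishing mean of \<open>g\<close>.\<close>
  have "((\<lambda>t. G (t + 1) - G t) has_real_derivative 0) (at t)" for t
    using DERIV_diff[OF DERIV_shift[THEN iffD1, OF G[of "t + 1"]] G[of t]] per[of t] by simp
  then have "G (t + 1) - G t = G (0 + 1) - G 0" for t
    using DERIV_isconst_all[of "\<lambda>t. G (t + 1) - G t" t 0] by simp
  then have 1: "G (t + 1) = G t" for t using 0 by simp
  show ?thesis by (rule that[of G]) (rule G, rule 1)
qed

lemma periodic_first_coordinate:
  assumes "\<And>t. P (t + 1) = P t"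
  shows "periodic (\<lambda>y::real^2. P (y $ 1))"
proof -
  interpret periodic_fun_simple P 1 using assms by unfold_locales
  show ?thesis unfolding periodic_def
  proof (intro allI impI)
    fix y m :: "real^2" assume "\<forall>k. m $ k \<in> \<int>"
    then have "m $ 1 \<in> \<int>" by simp
    then obtain n where "m $ 1 = of_int n" by (rule Ints_cases)
    then show "P ((y + m) $ 1) = P (y $ 1)" using plus_of_int[of "y $ 1" n] by simp
  qed
qed

lemma partial_deriv_first_coordinate:
  assumes "\<And>t. (P has_real_derivative Q t) (at t)"
  shows "partial_deriv a (\<lambda>y::real^2. P (y $ 1)) = (\<lambda>y. (if a = 1 then 1 else 0) * Q (y $ 1))"
  by (rule ext)
    (simp only: partial_deriv_real_compose[OF smooth_differentiable[OF smooth_coordinate] assms] partial_deriv_coordinate)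

lemma smooth_first_coordinate:
  assumes P: "\<And>t. (P has_real_derivative Q t) (at t)" and Q: "smooth (\<lambda>y::real^2. Q (y $ 1))"
  shows "smooth (\<lambda>y::real^2. P (y $ 1))"
proof (rule smooth_of_partials)
  show "(\<lambda>y. P (y $ 1)) differentiable at y" for y :: "real^2"
    by (rule differentiable_real_compose[OF smooth_differentiable[OF smooth_coordinate] P])
  show "smooth (partial_deriv a (\<lambda>y::real^2. P (y $ 1)))" for a
    unfolding partial_deriv_first_coordinate[OF P] by (intro smooth_intros Q)
qed

text \<open>Integrate \<open>\<eta>\<close> - 1 twice in the first coordinate; each integration
  stays periodic only if the integrand has mean zero.\<close>

lemma potential_with_hessian:
  fixes \<eta> :: "real \<Rightarrow> real"
  assumes sm: "smooth (\<lambda>y::real^2. \<eta> (y $ 1))" and per: "\<And>t. \<eta> (t + 1) = \<eta> t"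
    and pos: "\<And>t. 0 < \<eta> t" and mean: "integral {0..1} \<eta> = 1"
  obtains u :: "real^2 \<Rightarrow> real" where "symplectic_potential u"
    "\<And>y. hessian u y = (\<chi> a b. if a = b then (if a = 1 then \<eta> (y $ 1) else 1) else 0)"
proof -
  have c: "continuous_on UNIV \<eta>"
  proof -
    have "continuous_on UNIV (\<lambda>t. pt t 0)" unfolding pt_def by (intro continuous_intros)
    from continuous_on_compose2[OF smooth_continuous[OF sm, of UNIV] this] show ?thesis by simp
  qed
  define g where "g t = \<eta> t - 1" for t
  have gc: "continuous_on UNIV g" unfolding g_def by (intro continuous_intros c)
  have "\<eta> integrable_on {0..1}"
    by (rule integrable_continuous_interval[OF continuous_on_subset[OF c]]) simp
  then have g_mean: "integral {0..1} g = 0"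
    unfolding g_def using mean by (subst integral_diff) (simp_all add: integrable_const_ivl)
  have g_per: "g (t + 1) = g t" for t by (simp add: g_def per)
  obtain G where G: "\<And>t. (G has_real_derivative g t) (at t)" "\<And>t. G (t + 1) = G t"
    by (rule periodic_antiderivative[OF gc g_per g_mean]) (rule that)
  \<comment> \<open>The first antiderivative is fixed only up to a constant, which is chosen here to
    give mean zero so that a second periodic integration is possible.\<close>
  define Q where "Q t = G t - integral {0..1} G" for t
  have Q: "(Q has_real_derivative g t) (at t)" for t
    unfolding Q_def using DERIV_diff[OF G(1) DERIV_const] by simp
  have Gc: "continuous_on UNIV G"
    using G(1) by (intro continuous_at_imp_continuous_on ballI DERIV_isCont)
  have "G integrable_on {0..1}"
    by (rule integrable_continuous_interval[OF continuous_on_subset[OF Gc]]) simp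
  then have Q_mean: "integral {0..1} Q = 0"
    unfolding Q_def by (subst integral_diff) (simp_all add: integrable_const_ivl)
  have Q_cont: "continuous_on UNIV Q" unfolding Q_def by (intro continuous_intros Gc)
  have Q_per: "Q (t + 1) = Q t" for t by (simp add: Q_def G(2))
  obtain P where P: "\<And>t. (P has_real_derivative Q t) (at t)" "\<And>t. P (t + 1) = P t"
    by (rule periodic_antiderivative[OF Q_cont Q_per Q_mean]) (rule that)
  define \<phi> where "\<phi> = (\<lambda>y::real^2. P (y $ 1))"
  have gs: "smooth (\<lambda>y::real^2. g (y $ 1))" unfolding g_def by (intro smooth_intros sm)
  have \<phi>: "smooth \<phi>" "periodic \<phi>"
    unfolding \<phi>_def
    by (rule smooth_first_coordinate[OF P(1) smooth_first_coordinate[OF Q gs]], rule periodic_first_coordinate[of P, OF P(2)])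
  have Qs: "smooth (\<lambda>y::real^2. Q (y $ 1))" by (rule smooth_first_coordinate[OF Q gs])
  have "partial_deriv b (partial_deriv a \<phi>) y = (if a = 1 \<and> b = 1 then g (y $ 1) else 0)" for a b y
  proof (cases "a = 1")
    case True
    then have "partial_deriv a \<phi> = (\<lambda>y. Q (y $ 1))"
      by (simp add: \<phi>_def partial_deriv_first_coordinate[OF P(1)])
    then show ?thesis using True by (simp add: partial_deriv_first_coordinate[OF Q])
  next
    case False
    then have "partial_deriv a \<phi> = (\<lambda>y. 0)"
      by (simp add: \<phi>_def partial_deriv_first_coordinate[OF P(1)])
    then show ?thesis using False by simp
  qed
  then have hess: "hessian (\<lambda>y. u0 y + \<phi> y) y = (\<chi> a b. if a = b then (if a = 1 then \<eta> (y $ 1) else 1) else 0)" for y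
    by (auto simp: vec_eq_iff hessian_u0_add[OF \<phi>(1)] g_def)
  have "pos_def (hessian (\<lambda>y. u0 y + \<phi> y) y)" for y
    unfolding pos_def_def
  proof (intro conjI allI impI)
    show "transpose (hessian (\<lambda>y. u0 y + \<phi> y) y) = hessian (\<lambda>y. u0 y + \<phi> y) y"
      by (auto simp: hess transpose_def vec_eq_iff)
    fix x :: "real^2" assume "x \<noteq> 0"
    then consider "x $ 1 \<noteq> 0" | "x $ 2 \<noteq> 0" by (auto simp: vec_eq_iff forall_2)
    then have "0 < \<eta> (y $ 1) * (x $ 1 * x $ 1) + x $ 2 * x $ 2"
    proof cases
      case 1
      have "0 < x $ 1 * x $ 1" by (rule ccontr) (use 1 in simp)
      then have "0 < \<eta> (y $ 1) * (x $ 1 * x $ 1)" by (rule mult_pos_pos[OF pos])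
      then show ?thesis by (rule add_pos_nonneg) simp
    next
      case 2
      have "0 < x $ 2 * x $ 2" by (rule ccontr) (use 2 in simp)
      then show ?thesis using pos[of "y $ 1"] by (intro add_nonneg_pos mult_nonneg_nonneg[OF _ zero_le_square]) simp_all
    qed
    then show "0 < x \<bullet> (hessian (\<lambda>y. u0 y + \<phi> y) y *v x)"
      by (simp add: hess inner_vec_def sum_2 matrix_vector_mult_def mult_ac)
  qed
  then have "symplectic_potential (\<lambda>y. u0 y + \<phi> y)"
    unfolding symplectic_potential_def using \<phi> by (intro conjI exI allI) simp_all
  then show ?thesis using hess by (rule that)
qed

text \<open>The rational function inverts \<open>bfun\<close> because 1 - r^2 h^2 becomes the square
  of (r^2 - b^2) / (r^2 + b^2), and b < r makes this quotient its positive root.\<close>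

lemma bfun_rational:
  fixes r b :: real
  assumes "0 < b" "b < r"
  defines "h \<equiv> 2 * b / (r * r + b * b)"
  shows "r\<^sup>2 * h\<^sup>2 < 1" "bfun (r\<^sup>2) h = b"
proof -
  define X where "X = r * r + b * b"
  have X: "0 < X" using assms unfolding X_def by (intro add_pos_pos mult_pos_pos) simp_all
  have lt: "b * b < r * r" using assms by (intro mult_strict_mono) simp_all
  have "1 - r\<^sup>2 * h\<^sup>2 = (X * X - 4 * (r * r) * (b * b)) / (X * X)"
    using X unfolding h_def X_def[symmetric] by (simp add: power2_eq_square diff_divide_distrib)
  also have "X * X - 4 * (r * r) * (b * b) = (r * r - b * b) * (r * r - b * b)"
    by (simp add: X_def algebra_simps)
  finally have eq: "1 - r\<^sup>2 * h\<^sup>2 = ((r * r - b * b) / X)\<^sup>2"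
    by (simp add: power2_eq_square)
  have pos: "0 < (r * r - b * b) / X" using lt X by simp
  then have "0 < ((r * r - b * b) / X)\<^sup>2" by (rule zero_less_power)
  then show "r\<^sup>2 * h\<^sup>2 < 1" unfolding eq[symmetric] by simp
  have "sqrt (1 - r\<^sup>2 * h\<^sup>2) = (r * r - b * b) / X"
    unfolding eq using pos by (intro real_sqrt_unique) simp_all
  then have "1 + sqrt (1 - r\<^sup>2 * h\<^sup>2) = (X + (r * r - b * b)) / X"
    using X by (simp add: add_divide_distrib)
  also have "X + (r * r - b * b) = 2 * (r * r)" by (simp add: X_def)
  finally have "1 + sqrt (1 - r\<^sup>2 * h\<^sup>2) = 2 * (r * r) / X" .
  moreover have "r\<^sup>2 * h = b * (2 * (r * r) / X)"
    by (simp add: h_def X_def power2_eq_square)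
  moreover have "2 * (r * r) / X \<noteq> 0" using X assms by simp
  ultimately show "bfun (r\<^sup>2) h = b" unfolding bfun_def by simp
qed

lemma (in rank_one_higgs) solution_exists:
  assumes c: "\<And>y. \<kappa> y = c" "0 < cmod c" "cmod c < 3 / 10"
    and w: "\<And>y. w y $ 1 = 1" "\<And>y. cmod (w y $ 2) \<le> 1" "indep2 w"
  shows "\<exists>u. solves_real_moment_map \<xi> u"
proof -
  define r where "r = cmod c"
  have r: "0 < r" "r < 3 / 10" using c by (simp_all add: r_def)
  define m where "m y = (cmod (w y $ 2))\<^sup>2" for y
  define m1 where "m1 t = m (pt t 0)" for t
  have m_nn: "0 \<le> m y" and m_le: "m y \<le> 1" for y
    using w(2) by (simp_all add: m_def power_le_one)
  have m_m1: "m y = m1 (y $ 1)" for y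
    unfolding m1_def m_def using indep2_pt[OF w(3)] by simp
  have m_smooth: "smooth m"
  proof -
    have "m = (\<lambda>y. Re (w y $ 2 * cnj (w y $ 2)))"
      unfolding m_def by (intro ext) (simp add: complex_mult_cnj cmod_power2)
    then show ?thesis by (simp only:) (intro smooth_intros smooth_w)
  qed
  have m1_cont: "continuous_on {0..1} m1"
  proof -
    have "continuous_on {0..1} (\<lambda>t. pt t 0)" unfolding pt_def by (intro continuous_intros)
    from continuous_on_compose2[OF smooth_continuous[OF m_smooth, of UNIV] this]
    show ?thesis unfolding m1_def by simp
  qed
  have m1: "0 \<le> m1 t" "m1 t \<le> 1" for t
    unfolding m1_def by (rule m_nn m_le)+
  obtain K where K: "9 / 10 \<le> K" "K \<le> 1" "integral {0..1::real} (\<lambda>t. eta_root r K (m1 t)) = 1"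
    by (rule eta_root_mean_1[OF r m1_cont m1])
  define b where "b y = psi_root r K (m y)" for y
  have "-1 < m y" "m y < 2" for y using m_nn[of y] m_le[of y] by simp_all
  then have b: "0 < b y" "b y < r" "psi r K (b y) = m y" for y
    unfolding b_def by (intro psi_root[OF r K(1,2)]; simp)+
  define \<eta> where "\<eta> t = eta_root r K (m1 t)" for t
  have \<eta>: "\<eta> (y $ 1) = 1 / (K + b y)" for y
    by (simp only: \<eta>_def eta_root_def b_def m_m1)
  have Kb: "0 < K + b y" for y using b(1)[of y] K by simp
  have \<eta>_smooth: "smooth (\<lambda>y::real^2. \<eta> (y $ 1))"
    unfolding \<eta>
  proof (intro smooth_intros)
    show "smooth b" unfolding b_def[abs_def] by (rule psi_root_smooth[OF r K(1,2) m_smooth m_nn m_le])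
    show "K + b y \<noteq> 0" for y using Kb[of y] by simp
  qed
  have \<eta>_per: "\<eta> (t + 1) = \<eta> t" for t
  proof -
    have "pt (t + 1) 0 = pt t 0 + axis 1 1" by (simp add: pt_def scaleR_left_distrib)
    then show ?thesis unfolding \<eta>_def m1_def m_def using periodic_axis[OF periodic_w, of "pt t 0" 1] by simp
  qed
  have \<eta>_pos: "0 < \<eta> t" for t using \<eta>[of "pt t 0"] Kb[of "pt t 0"] by simp
  obtain u :: "real^2 \<Rightarrow> real" where u: "symplectic_potential u"
    "\<And>y. hessian u y = (\<chi> a b. if a = b then (if a = 1 then \<eta> (y $ 1) else 1) else 0)"
    by (rule potential_with_hessian[OF \<eta>_smooth \<eta>_per \<eta>_pos K(3)[folded \<eta>_def]]) (rule that)
  have "herm (w y) 2 2 = m y" for y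
    unfolding herm_def m_def by (simp add: complex_mult_cnj cmod_power2)
  \<comment> \<open>For the Hessian diag(\<eta>, 1) and w1 = 1 the left side is \<eta> + m, and
    \<open>psi r K b = m\<close> rewrites it so that \<open>bfun_rational\<close> applies. The flux
    then becomes 1/\<eta> - b = K.\<close>
  then have h: "hval (hessian u y) (w y) = 2 * b y / (r * r + b y * b y)" for y
    using b(3)[of y] unfolding psi_def by (simp add: hval_def u(2) \<eta> herm_def w(1))
  have "solves_real_moment_map \<xi> u"
  proof (rule solves_of_indep2[OF u(1)])
    show "(cmod (\<kappa> y))\<^sup>2 * (hval (hessian u y) (w y))\<^sup>2 < 1" for y
      unfolding h c(1) r_def[symmetric] by (rule bfun_rational(1)[OF b(1,2)])
    show "indep2 \<kappa>" by (simp add: indep2_def c(1))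
    have first: "(y + s *\<^sub>R axis 2 1) $ 1 = y $ 1" for y :: "real^2" and s :: real by (simp add: axis_def)
    show "indep2 (hessian u)" unfolding indep2_def u(2) by (simp only: first simp_thms)
    have "bfun ((cmod (\<kappa> y))\<^sup>2) (hval (hessian u y) (w y)) = b y" for y
      unfolding h c(1) r_def[symmetric] by (rule bfun_rational(2)[OF b(1,2)])
    then show "flux (\<kappa> y) (w y) (hessian u y) 1 1 = K" for y
      using Kb[of y] by (simp add: flux_def inv2_simps u(2) herm_def w(1) \<eta>)
  qed (rule w(3))
  then show ?thesis by (rule exI[of _ u])
qed

text \<open>A continuous function on a connected space with at most two values is constant. In case
  (ii) this passes from \<xi>^22, hence the square of \<xi>^12, to \<xi>^12 without a choice of sign
  at each point.\<close>

lemma constant_on_of_square_constant: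
  fixes f :: "'a::real_normed_vector \<Rightarrow> complex"
  assumes "continuous_on UNIV f" "\<And>x. (f x)\<^sup>2 = s"
  shows "\<exists>k. \<forall>x. f x = k"
proof -
  have "(f x)\<^sup>2 = (csqrt s)\<^sup>2" for x by (simp only: assms(2) power2_csqrt)
  then have "f x \<in> {csqrt s, - csqrt s}" for x
    using power2_eq_iff[of "f x" "csqrt s"] by simp
  then have "range f \<subseteq> {csqrt s, - csqrt s}" by (rule image_subsetI)
  then have "finite (range f)" by (rule finite_subset) simp
  from continuous_finite_range_constant[OF connected_UNIV assms(1) this]
  show ?thesis by (simp add: constant_on_def)
qed

theorem theorem1p11:
  fixes \<xi> :: "real^2 \<Rightarrow> complex^2^2"
  assumes higgs: "higgs_tensor \<xi>"
    and y1_only: "\<exists>\<Xi>. \<forall>y. \<xi> y = \<Xi> (y $ 1)"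
    and complex_eq: "complex_moment_map_eq \<xi>"
    and degenerate: "\<forall>y. det (\<xi> y) = 0"
  shows
    "(\<exists>f :: real \<Rightarrow> complex.
        (\<forall>y. \<xi> y = vector [vector [0, 0], vector [0, f (y $ 1)]]) \<and>
        ((\<forall>t. cmod (f t) < 1) \<longrightarrow>
          (\<forall>u. solves_real_moment_map \<xi> u \<longleftrightarrow> (\<exists>k. u = (\<lambda>y. u0 y + k)))) \<and>
        (\<forall>u. solves_real_moment_map \<xi> u \<longrightarrow>
          (integrable_deformation \<xi> u \<longleftrightarrow> \<xi> constant_on UNIV)))
     \<or>
     (\<exists>(c :: complex) (f :: real \<Rightarrow> complex). c \<noteq> 0 \<and>
        (\<forall>y. \<xi> y = vector [vector [c, f (y $ 1)], vector [f (y $ 1), (f (y $ 1))\<^sup>2 / c]]) \<and>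
        ((\<forall>t. cmod (f t) \<le> cmod c) \<and> cmod c < 3 / 10 \<longrightarrow>
          (\<exists>u. solves_real_moment_map \<xi> u \<and>
            (\<forall>v. solves_real_moment_map \<xi> v \<longleftrightarrow> (\<exists>k. v = (\<lambda>y. u y + k))))) \<and>
        (\<forall>u. solves_real_moment_map \<xi> u \<longrightarrow>
          (integrable_deformation \<xi> u \<longleftrightarrow> \<xi> constant_on UNIV)))"
proof -
  obtain \<Xi> where \<Xi>: "\<xi> = (\<lambda>y. \<Xi> (y $ 1))" using y1_only by (auto simp: fun_eq_iff)
  have indep: "indep2 \<xi>" unfolding \<Xi> by (rule indep2_first_coordinate)
  then have indep_nth: "indep2 (\<lambda>y. \<xi> y $ a $ b)" for a b by (simp add: indep2_def)
  have \<xi>: "smooth \<xi>" "periodic \<xi>" "\<And>y. transpose (\<xi> y) = \<xi> y"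
    using higgs unfolding higgs_tensor_def by simp_all
  have smooth_nth: "smooth (\<lambda>y. \<xi> y $ a $ b)" for a b by (intro smooth_intros \<xi>(1))
  have periodic_nth: "periodic (\<lambda>y. \<xi> y $ a $ b)" for a b using \<xi>(2) by (simp add: periodic_def)
  have sym: "\<xi> y $ 2 $ 1 = \<xi> y $ 1 $ 2" for y
    using arg_cong[OF \<xi>(3)[of y], of "\<lambda>A. A $ 1 $ 2"] by (simp add: transpose_def)
  have det: "\<xi> y $ 1 $ 1 * \<xi> y $ 2 $ 2 = (\<xi> y $ 1 $ 2)\<^sup>2" for y
    using degenerate sym[of y] by (simp add: det_2 power2_eq_square)
  have "partial_deriv 1 (partial_deriv 1 (\<lambda>y. \<xi> y $ 1 $ 1)) y = 0" for y
    using complex_eq unfolding complex_moment_map_eq_def div2_indep2[OF indep_nth] by simp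
  then have "\<exists>k. \<forall>y. partial_deriv 1 (\<lambda>y. \<xi> y $ 1 $ 1) y = k"
    by (rule const_of_indep2_partial_zero[OF smooth_partial[OF smooth_nth] indep2_partial[OF indep_nth]])
  then obtain k where k: "\<forall>y. partial_deriv 1 (\<lambda>y. \<xi> y $ 1 $ 1) y = k" ..
  have "partial_deriv 1 (\<lambda>y. \<xi> y $ 1 $ 1) y = 0" for y
    by (rule partial_deriv_zero_of_line_const[OF periodic_nth smooth_differentiable[OF smooth_nth]]) (simp only: k)
  then have "\<exists>c. \<forall>y. \<xi> y $ 1 $ 1 = c"
    by (rule const_of_indep2_partial_zero[OF smooth_nth indep_nth])
  then obtain c where "\<forall>y. \<xi> y $ 1 $ 1 = c" ..
  then have c: "\<xi> y $ 1 $ 1 = c" for y by simp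
  have pt: "\<xi> (pt (y $ 1) 0) = \<xi> y" for y by (rule indep2_pt[OF indep])
  show ?thesis
  proof (cases "c = 0")
    case True
    have 12: "\<xi> y $ 1 $ 2 = 0" for y using det[of y] c[of y] True by simp
    define f where "f t = \<xi> (pt t 0) $ 2 $ 2" for t
    have f: "f (y $ 1) = \<xi> y $ 2 $ 2" for y by (simp only: f_def pt)
    let ?\<kappa> = "\<lambda>y. \<xi> y $ 2 $ 2" and ?w = "\<lambda>y::real^2. vector [0, 1] :: complex^2"
    interpret rank_one_higgs ?\<kappa> ?w \<xi>
    proof
      show "\<xi> y = rank_one (\<xi> y $ 2 $ 2) (vector [0, 1])" for y
        by (simp add: rank_one_def vec_eq_iff forall_2 c True 12 sym)
      show "smooth (\<lambda>y::real^2. (vector [0, 1] :: complex^2) $ a)" for a by (rule smooth_const)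
      show "periodic ?w" by (simp add: periodic_def)
      show "(vector [0, 1] :: complex^2) \<noteq> 0" by (simp add: vec_eq_iff forall_2)
    qed (rule smooth_nth periodic_nth)+
    have u0: "solves_real_moment_map \<xi> u0" if f1: "\<forall>t. cmod (f t) < 1"
    proof -
      have hess: "hessian (u0 :: real^2 \<Rightarrow> real) y = mat 1" for y
        using hessian_u0_add[OF smooth_const[of 0], of y] by (simp add: vec_eq_iff mat_def)
      have "pos_def (mat 1 :: real^2^2)"
        unfolding pos_def_def by (simp add: transpose_mat)
      then have pot: "symplectic_potential (u0 :: real^2 \<Rightarrow> real)"
        unfolding symplectic_potential_def hess
        by (intro conjI exI[of _ "\<lambda>y. 0"] allI) (simp_all add: smooth_const periodic_def)
      show ?thesis
      proof (rule solves_of_indep2[OF pot])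
        have "hval (hessian u0 y) (vector [0, 1]) = 1" for y
          by (simp add: hess hval_def herm_def mat_def)
        moreover have "(cmod (\<xi> y $ 2 $ 2))\<^sup>2 < 1" for y
          using f1[rule_format, of "y $ 1"] by (simp add: f power_less_one_iff abs_square_less_1)
        ultimately show "(cmod (\<xi> y $ 2 $ 2))\<^sup>2 * (hval (hessian u0 y) (vector [0, 1]))\<^sup>2 < 1" for y
          by simp
        \<comment> \<open>Since w1 = 0, the Higgs term is absent from this entry and the inverse of
          the identity alone remains.\<close>
        show "flux (\<xi> y $ 2 $ 2) (vector [0, 1]) (hessian u0 y) 1 1 = 1" for y
          by (simp add: flux_def hess inv2_simps mat_def herm_def)
        show "indep2 (\<lambda>y. \<xi> y $ 2 $ 2)" by (rule indep_nth)
      qed (simp_all add: indep2_def hess)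
    qed
    have int: "integrable_deformation \<xi> u \<longleftrightarrow> \<xi> constant_on UNIV" if "solves_real_moment_map \<xi> u" for u
    proof (rule integrable_iff_constant[OF that indep])
      assume "\<And>y. partial_deriv 1 (\<lambda>y. \<xi> y $ 2 $ 2) y = 0"
      then have "\<exists>d. \<forall>y. \<xi> y $ 2 $ 2 = d"
        by (rule const_of_indep2_partial_zero[OF smooth_nth indep_nth])
      then obtain d where "\<forall>y. \<xi> y $ 2 $ 2 = d" ..
      then have "\<xi> y = (\<chi> a b. if a = 2 \<and> b = 2 then d else 0)" for y
        by (simp add: vec_eq_iff forall_2 c True 12 sym)
      then show "\<xi> constant_on UNIV" unfolding constant_on_def by (intro exI ballI)
    qed
    show ?thesis
    proof (rule disjI1, intro exI[of _ f] conjI allI impI)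
      show "\<xi> y = vector [vector [0, 0], vector [0, f (y $ 1)]]" for y
        by (simp add: vec_eq_iff forall_2 c True 12 sym f)
    qed (rule solution_unique[OF u0] int, assumption)+
  next
    case False
    define f where "f t = \<xi> (pt t 0) $ 1 $ 2" for t
    have f: "f (y $ 1) = \<xi> y $ 1 $ 2" for y by (simp only: f_def pt)
    have 22: "\<xi> y $ 2 $ 2 = (\<xi> y $ 1 $ 2)\<^sup>2 / c" for y
      using det[of y] False by (simp add: c nonzero_eq_divide_eq mult.commute)
    let ?w = "\<lambda>y. vector [1, \<xi> y $ 1 $ 2 / c] :: complex^2"
    interpret rank_one_higgs "\<lambda>y. c" ?w \<xi>
    proof
      show "\<xi> y = rank_one c (?w y)" for y
        using False by (simp add: rank_one_def vec_eq_iff forall_2 c sym 22 power2_eq_square)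
      have "smooth (\<lambda>y. \<xi> y $ 1 $ 2 / c)"
        unfolding divide_inverse by (intro smooth_intros smooth_nth)
      then show "smooth (\<lambda>y. ?w y $ a)" for a
        using exhaust_2[of a] smooth_const[of "1::complex"] by auto
      show "periodic ?w" using periodic_nth[of 1 2] by (simp add: periodic_def)
      show "?w y \<noteq> 0" for y by (simp add: vec_eq_iff forall_2)
      show "periodic (\<lambda>y. c)" by (simp add: periodic_def)
    qed (rule smooth_const)
    have ex: "\<exists>u. solves_real_moment_map \<xi> u" if "(\<forall>t. cmod (f t) \<le> cmod c) \<and> cmod c < 3 / 10"
    proof (rule solution_exists[of c])
      show "cmod (?w y $ 2) \<le> 1" for y
        using that False by (simp add: f[symmetric] norm_divide divide_le_eq_1)
      show "indep2 ?w" using indep_nth[of 1 2] by (simp add: indep2_def)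
    qed (use that False in simp_all)
    have int: "integrable_deformation \<xi> u \<longleftrightarrow> \<xi> constant_on UNIV" if "solves_real_moment_map \<xi> u" for u
    proof (rule integrable_iff_constant[OF that indep])
      assume "\<And>y. partial_deriv 1 (\<lambda>y. \<xi> y $ 2 $ 2) y = 0"
      then have "\<exists>d. \<forall>y. \<xi> y $ 2 $ 2 = d"
        by (rule const_of_indep2_partial_zero[OF smooth_nth indep_nth])
      then obtain d where d: "\<forall>y. \<xi> y $ 2 $ 2 = d" ..
      \<comment> \<open>Vanishing of the determinant turns constancy of \<xi>^22 into constancy of
        the square of \<xi>^12.\<close>
      have "(\<xi> y $ 1 $ 2)\<^sup>2 = c * d" for y using det[of y] d by (simp add: c)
      then have "\<exists>e. \<forall>y. \<xi> y $ 1 $ 2 = e"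
        by (rule constant_on_of_square_constant[OF smooth_continuous[OF smooth_nth]])
      then obtain e where "\<forall>y. \<xi> y $ 1 $ 2 = e" ..
      then have "\<xi> y = vector [vector [c, e], vector [e, d]]" for y
        using d by (simp add: vec_eq_iff forall_2 c sym)
      then show "\<xi> constant_on UNIV" unfolding constant_on_def by (intro exI ballI)
    qed
    show ?thesis
    proof (rule disjI2, intro exI[of _ c] exI[of _ f] conjI)
      show "\<forall>y. \<xi> y = vector [vector [c, f (y $ 1)], vector [f (y $ 1), (f (y $ 1))\<^sup>2 / c]]"
        by (simp add: vec_eq_iff forall_2 c sym f 22)
      show "(\<forall>t. cmod (f t) \<le> cmod c) \<and> cmod c < 3 / 10 \<longrightarrow>
          (\<exists>u. solves_real_moment_map \<xi> u \<and>
            (\<forall>v. solves_real_moment_map \<xi> v \<longleftrightarrow> (\<exists>k. v = (\<lambda>y. u y + k))))"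
      proof
        assume "(\<forall>t. cmod (f t) \<le> cmod c) \<and> cmod c < 3 / 10"
        from ex[OF this] obtain u where "solves_real_moment_map \<xi> u" ..
        then show "\<exists>u. solves_real_moment_map \<xi> u \<and>
            (\<forall>v. solves_real_moment_map \<xi> v \<longleftrightarrow> (\<exists>k. v = (\<lambda>y. u y + k)))"
          using solution_unique by (intro exI conjI allI)
      qed
    qed (use False int in simp_all)
  qed
qed

end
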